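(* For all integers $1\le k\le n$, $$V_{n,k}(t)=\sum_{\sigma\in\mathcal{RS}\mathrm{I}^{(B)}_{n,n-k+1}} t^{\,n+1-2\,\mathrm{npk}(\sigma)}\quad\text{and}\quad V_{n,-k}(t)=\sum_{\sigma\in\mathcal{RS}\mathrm{I}^{(D)}_{n,-n+k-1}} t^{\,n-1-2\,\mathrm{npk}(\sigma)}.$$
   Context: The polynomials $V_{n,k}=V_{n,k}(t)$, for integers $n\ge1$ and $1\le |k|\le n$, are defined by $V_{1,1}=t^2$, $V_{1,-1}=1$, $V_{n,-n}=0$ for $n\ge 2$, and the recurrences $V_{n,-k}=V_{n,-k-1}+t^{-1}V_{n-1,k}$ for $n>k\ge 1$; $V_{n,1}=t^2\,V_{n,-1}$ for $n\ge 2$; $V_{n,k}=V_{n,k-1}+t\,V_{n-1,-k+1}$ for $n\ge k>1$. $\mathfrak{S}_n$ is the symmetric group on $[n]=\{1,\dots,n\}$, with permutations written as words. A double descent of a word of distinct integers is a triple of consecutive letters $a>b>c$. A permutation $\sigma\in\mathfrak{S}_n$ is a Simsun permutation if for all $1\le k\le n$, the subword of $\sigma$ consisting of the letters $1,\dots,k$ (in the order they appear in $\sigma$) has no double descent. A signed permutation of $[n]$ is a bijection $\sigma$ of $\{\pm1,\dots,\pm n\}$ onto itself with $\sigma(-i)=-\sigma(i)$, written $\sigma=(\sigma_1,\dots,\sigma_n)$ with $\sigma_i=\sigma(i)$; $B_n$ is the set of these. Put $|\sigma|=(|\sigma_1|,\dots,|\sigma_n|)\in\mathfrak{S}_n$.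 $\mathcal{RS}\mathrm{I}_n$ is the set of $\sigma\in B_n$ such that $|\sigma|$ is a Simsun permutation. For $\sigma\in\mathcal{RS}\mathrm{I}_n$, $\mathrm{npk}(\sigma)=\#\{i: 1\le i\le n-1,\ \sigma_i<0,\ |\sigma_i|>|\sigma_{i+1}|\}$. $\mathcal{RS}\mathrm{I}^{(B)}_n$ is the set of $\sigma\in\mathcal{RS}\mathrm{I}_n$ such that $\sigma_i>0$ for every $1\le i\le n$ with $|\sigma_i|=\min\{|\sigma_i|,|\sigma_{i+1}|,\dots,|\sigma_n|\}$. $\mathcal{RS}\mathrm{I}^{(D)}_n$ is the set of $\sigma\in\mathcal{RS}\mathrm{I}_n$ such that $\sigma_n<0$, $|\sigma_n|>\sigma_{n-1}$ (with $\sigma_0=0$), and $\sigma_i>0$ for every $1\le i\le n-1$ with $|\sigma_i|=\min\{|\sigma_i|,|\sigma_{i+1}|,\dots,|\sigma_{n-1}|\}$; in particular $\mathcal{RS}\mathrm{I}^{(D)}_1=\{(-1)\}$. For $1\le k\le n$, $\mathcal{RS}\mathrm{I}^{(B)}_{n,k}=\{\sigma\in\mathcal{RS}\mathrm{I}^{(B)}_n:\sigma_n=k\}$ and $\mathcal{RS}\mathrm{I}^{(D)}_{n,-k}=\{\sigma\in\mathcal{RS}\mathrm{I}^{(D)}_n:\sigma_n=-k\}$. *)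

theory Defs
  imports
    "HOL-Computational_Algebra.Formal_Laurent_Series"
    "HOL-Combinatorics.Multiset_Permutations"
begin

text \<open>
  Because the recurrences involve \<open>t\<^sup>-\<^sup>1\<close>, the polynomials \<open>V\<^sub>n\<^sub>,\<^sub>k\<close> are elements of the ring
  of formal Laurent series over the integers, with \<open>t\<close> = \<^const>\<open>fls_X\<close>,
  \<open>t\<^sup>-\<^sup>1\<close> = \<^const>\<open>fls_X_inv\<close>, and \<open>t\<^sup>e\<close> = \<^term>\<open>fls_X_intpow e\<close> for an integer \<open>e\<close>.
  The value outside \<open>1 \<le> \<bar>k\<bar> \<le> n\<close> is the dummy \<open>0\<close>; it is never used by the recurrences.
\<close>

function V :: "nat \<Rightarrow> int \<Rightarrow> int fls" where
  "V n k =
    (if k = 0 \<or> \<bar>k\<bar> > int n then 0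
     else if n = 1 then (if k = 1 then fls_X\<^sup>2 else 1)
     else if k = - int n then 0
     else if k < 0 then V n (k - 1) + fls_X_inv * V (n - 1) (- k)
     else if k = 1 then fls_X\<^sup>2 * V n (- 1)
     else V n (k - 1) + fls_X * V (n - 1) (1 - k))"
  by pat_completeness auto
termination
  by (relation "measures [fst, \<lambda>(n, k). nat (int n + k)]") auto

declare V.simps [simp del]

lemma V_1_pos: "V 1 1 = fls_X\<^sup>2"
  and V_1_neg: "V 1 (- 1) = 1"
  by (simp_all add: V.simps)

lemma V_neg_n: "n \<ge> 2 \<Longrightarrow> V n (- int n) = 0"
  by (simp add: V.simps)

lemma V_neg:
  assumes "1 \<le> k" and "k < n"
  shows "V n (- int k) = V n (- int k - 1) + fls_X_inv * V (n - 1) (int k)"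
  using assms by (subst V.simps) auto

lemma V_one: "n \<ge> 2 \<Longrightarrow> V n 1 = fls_X\<^sup>2 * V n (- 1)"
  by (subst V.simps) auto

lemma V_pos:
  assumes "1 < k" and "k \<le> n"
  shows "V n (int k) = V n (int k - 1) + fls_X * V (n - 1) (- int k + 1)"
  using assms by (subst V.simps) auto

definition has_double_descent :: "int list \<Rightarrow> bool" where
  "has_double_descent w \<longleftrightarrow>
     (\<exists>i. i + 2 < length w \<and> w ! i > w ! (i + 1) \<and> w ! (i + 1) > w ! (i + 2))"

definition simsun :: "nat \<Rightarrow> int list set" where
  "simsun n = {w \<in> permutations_of_set {1..int n}.
     \<forall>k\<in>{1..int n}. \<not> has_double_descent (filter (\<lambda>x. x \<le> k) w)}"

text \<open>
  A signed permutation is a function on \<^typ>\<open>int\<close> that is the identity outside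
  \<open>{\<plusminus>1, \<dots>, \<plusminus>n}\<close>.  In particular \<open>\<sigma> 0 = 0\<close>, which is the convention \<open>\<sigma>\<^sub>0 = 0\<close>.
\<close>

definition signed_perms :: "nat \<Rightarrow> (int \<Rightarrow> int) set" where
  "signed_perms n = {\<sigma>. \<sigma> permutes ({- int n..-1} \<union> {1..int n}) \<and> (\<forall>i. \<sigma> (- i) = - \<sigma> i)}"

definition abs_word :: "nat \<Rightarrow> (int \<Rightarrow> int) \<Rightarrow> int list" where
  "abs_word n \<sigma> = map (\<lambda>i. \<bar>\<sigma> i\<bar>) [1..int n]"

definition RSI :: "nat \<Rightarrow> (int \<Rightarrow> int) set" where
  "RSI n = {\<sigma> \<in> signed_perms n. abs_word n \<sigma> \<in> simsun n}"

definition npk :: "nat \<Rightarrow> (int \<Rightarrow> int) \<Rightarrow> nat" where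
  "npk n \<sigma> = card {i \<in> {1..int n - 1}. \<sigma> i < 0 \<and> \<bar>\<sigma> i\<bar> > \<bar>\<sigma> (i + 1)\<bar>}"

definition RSI_B :: "nat \<Rightarrow> (int \<Rightarrow> int) set" where
  "RSI_B n = {\<sigma> \<in> RSI n.
     \<forall>i\<in>{1..int n}. \<bar>\<sigma> i\<bar> = Min ((\<lambda>j. \<bar>\<sigma> j\<bar>) ` {i..int n}) \<longrightarrow> \<sigma> i > 0}"

definition RSI_D :: "nat \<Rightarrow> (int \<Rightarrow> int) set" where
  "RSI_D n = {\<sigma> \<in> RSI n.
     \<sigma> (int n) < 0 \<and> \<bar>\<sigma> (int n)\<bar> > \<sigma> (int n - 1) \<and>
     (\<forall>i\<in>{1..int n - 1}. \<bar>\<sigma> i\<bar> = Min ((\<lambda>j. \<bar>\<sigma> j\<bar>) ` {i..int n - 1}) \<longrightarrow> \<sigma> i > 0)}"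

definition RSI_B_last :: "nat \<Rightarrow> int \<Rightarrow> (int \<Rightarrow> int) set" where
  "RSI_B_last n m = {\<sigma> \<in> RSI_B n. \<sigma> (int n) = m}"

definition RSI_D_last :: "nat \<Rightarrow> int \<Rightarrow> (int \<Rightarrow> int) set" where
  "RSI_D_last n m = {\<sigma> \<in> RSI_D n. \<sigma> (int n) = m}"

lemma finite_signed_perms: "finite (signed_perms n)"
  unfolding signed_perms_def
  by (rule finite_subset [OF _ finite_permutations [of "{- int n..-1} \<union> {1..int n}"]]) auto

lemma finite_RSI_B_last: "finite (RSI_B_last n m)"
  and finite_RSI_D_last: "finite (RSI_D_last n m)"
  by (auto intro!: finite_subset [OF _ finite_signed_perms [of n]]
      simp: RSI_B_last_def RSI_D_last_def RSI_B_def RSI_D_def RSI_def)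

end

theory Submission
  imports Defs
begin

text \<open>
  Write \<open>t\<close> for \<^term>\<open>fls_X\<close>, and let \<open>b(n,m)\<close> and \<open>d(n,m)\<close> be the sums over the signed Simsun
  permutations of types B and D with last letter \<open>m\<close> and \<open>-m\<close>.  With \<open>m = n - k + 1\<close> the recurrences
  of the \<open>V\<^sub>n\<^sub>,\<^sub>k\<close> become
  \<open>d(n,1) = 0\<close>, \<open>d(n,m+1) = d(n,m) + t\<^sup>-\<^sup>1 b(n-1,m)\<close>, \<open>b(n,n) = t\<^sup>2 d(n,n)\<close> and
  \<open>b(n,m) - b(n,m+1) = t d(n-1,m)\<close>.

  All but the last are visible on the permutations.  If the last letter is \<open>\<plusminus>n\<close>, changing its sign
  exchanges the types B and D.  The condition of type D says
  that \<open>\<sigma>\<close> is a permutation of type B of length \<open>n - 1\<close> to which a negative letter, larger in absolute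
  value than the preceding one, has been appended.  Appending a letter above the last one, while
  shifting the letters that are not below it to make room,
  never destroys the Simsun property, so \<open>d(n,m) = t\<^sup>-\<^sup>1 (b(n-1,1) + \<dots> + b(n-1,m-1))\<close>.

  The last recurrence resists such an argument: exchanging the values \<open>m\<close> and \<open>m + 1\<close> respects
  neither the Simsun property nor the positions whose signs are free.  It follows instead from a second
  description of the Simsun permutations, by insertion of the largest letter.  In type B the signs are
  free exactly at the letters that are followed by some smaller one, and a negative sign matters only
  at a descent.  Summing over the signs, a word \<open>w\<close> of length \<open>n\<close> contributes
  \<open>t\<^sup>n\<^sup>+\<^sup>1 2\<^sup>e (1 + t\<^sup>-\<^sup>2)\<^sup>d\<close>, where \<open>d\<close> is the number of descents and \<open>e\<close> that of the remaining
  free positions (\<open>word_weight_eq_sum\<close>).  The letter \<open>n + 1\<close> may be inserted anywhere except in front of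
  a descent.  Since there are no double descents, exactly \<open>d\<close> of the allowed positions that are not at
  the end lie inside a descent and keep the number of descents, and the other \<open>n - 2d\<close> raise it by one.
  These numbers are just such that the contributions of the resulting words add up to
  \<open>\<Lambda> f = (1 + t\<^sup>2) (f' - t\<^sup>-\<^sup>1 f)\<close>, applied to the contribution \<open>f\<close> of \<open>w\<close>
  (\<open>sum_word_weight_insert_at\<close>).

  Hence \<open>b(n,m) = \<Lambda> b(n-1,m)\<close> for \<open>m < n\<close>, with an operator that is linear and does not depend on
  \<open>n\<close>, and so the last recurrence propagates from \<open>n - 1\<close> to \<open>n\<close> when \<open>m < n - 1\<close>.  The boundary case
  \<open>m = n - 1\<close> comes from the commutation rule \<open>\<Lambda>(t f) = t \<Lambda> f + (1 + t\<^sup>2) f\<close>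
  (\<open>V_eq_by_recurrences\<close>).
\<close>

section \<open>The insertion operator on Laurent series\<close>

lemma fls_X_times_X_inv: "fls_X * fls_X_inv = (1 :: 'a :: semiring_1 fls)"
  by (simp add: fls_X_inv_conv_shift_1 fls_X_times_conv_shift)

lemma fls_X_intpow_eq:
  "fls_X_intpow (int a - 2 * int p) = (fls_X ^ a * (fls_X_inv\<^sup>2) ^ p :: 'a :: comm_ring_1 fls)"
  unfolding power_mult [symmetric]
  by (simp add: fls_X_power_conv_shift_1 fls_X_inv_power_conv_shift_1 fls_shifted_times_simps)

lemma fls_deriv_power:
  "fls_deriv (f ^ n) = of_nat n * f ^ (n - 1) * fls_deriv (f :: 'a :: comm_ring_1 fls)"
proof (induction n)
  case (Suc n)
  then show ?case
    by (cases n) (simp_all add: algebra_simps)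
qed simp

text \<open>
  This is the operator \<open>\<Lambda>\<close>, equivalently \<open>f \<mapsto> (t\<^sup>3 + t) (f / t)'\<close>.  It describes the effect on
  generating functions of inserting a new largest letter before the last letter of a word.
\<close>

definition insert_max :: "int fls \<Rightarrow> int fls" where
  "insert_max f = (1 + fls_X\<^sup>2) * (fls_deriv f - fls_X_inv * f)"

lemma insert_max_add: "insert_max (f + g) = insert_max f + insert_max g"
  and insert_max_diff: "insert_max (f - g) = insert_max f - insert_max g"
  and insert_max_0: "insert_max 0 = 0"
  by (simp_all add: insert_max_def algebra_simps)

lemma insert_max_sum: "insert_max (sum f A) = (\<Sum>x\<in>A. insert_max (f x))"
  by (induction A rule: infinite_finite_induct) (simp_all add: insert_max_add insert_max_0)

text \<open>
  In the recurrences below \<open>t\<close> is the value of \<open>t d(1,1)\<close>, and the empty sum \<open>t d(2,1) = 0\<close> is its image.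
\<close>

lemma insert_max_X: "insert_max fls_X = 0"
  by (simp add: insert_max_def fls_X_times_X_inv mult.commute)

lemma insert_max_X_mult:
  "insert_max (fls_X * f) = fls_X * insert_max f + (1 + fls_X\<^sup>2) * f"
  by (simp add: insert_max_def algebra_simps)

text \<open>
  Read combinatorially: a word of length \<open>n\<close> with \<open>d\<close> descents and \<open>e\<close> further letters of free sign
  admits \<open>d\<close> insertions that increase \<open>e\<close> and \<open>n - 2d\<close> insertions that increase \<open>d\<close>.  Differentiating
  \<open>t\<^sup>n z\<^sup>d\<close> with \<open>z = 1 + t\<^sup>-\<^sup>2\<close> yields \<open>n t\<^sup>n\<^sup>-\<^sup>1 z\<^sup>d - 2d t\<^sup>n\<^sup>-\<^sup>3 z\<^sup>d\<^sup>-\<^sup>1\<close>, and the factor \<open>t\<^sup>3 + t = t\<^sup>3 z\<close> restores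
  the lost \<open>z\<close>.  The claim then follows from \<open>t\<^sup>n z\<^sup>d = t\<^sup>n\<^sup>+\<^sup>2 (z - 1) z\<^sup>d\<close>.
\<close>

lemma insert_max_weight:
  "insert_max (fls_X ^ (n + 1) * 2 ^ e * (1 + fls_X_inv\<^sup>2) ^ d) =
     of_nat d * (fls_X ^ (n + 2) * 2 ^ (e + 1) * (1 + fls_X_inv\<^sup>2) ^ d) +
     (of_nat n - 2 * of_nat d) * (fls_X ^ (n + 2) * 2 ^ e * (1 + fls_X_inv\<^sup>2) ^ (d + 1))"
proof -
  define X Y z where "X = (fls_X :: int fls)" and "Y = (fls_X_inv :: int fls)" and "z = 1 + Y\<^sup>2"
  have XY: "X * Y = 1"
    by (simp add: X_def Y_def fls_X_times_X_inv)
  have dX: "fls_deriv (X ^ (n + 1)) = of_nat (n + 1) * X ^ n"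
    by (simp only: fls_deriv_power) (simp add: X_def)
  have dz: "fls_deriv (z ^ d) = of_nat d * z ^ (d - 1) * (- 2 * Y ^ 3)"
    by (simp only: fls_deriv_power) (simp add: z_def Y_def power2_eq_square power3_eq_cube)
  have d2: "fls_deriv (2 ^ e :: int fls) = 0"
    by (simp add: fls_deriv_power)
  have expand: "fls_deriv (X ^ (n + 1) * 2 ^ e * z ^ d) =
      of_nat (n + 1) * X ^ n * 2 ^ e * z ^ d + X ^ (n + 1) * 2 ^ e * (of_nat d * z ^ (d - 1) * (- 2 * Y ^ 3))"
    by (simp only: fls_deriv_mult dX dz d2) (simp add: algebra_simps)
  have zX: "1 + X\<^sup>2 = X\<^sup>2 * z"
    using XY by (simp add: z_def) algebra
  have zd: "of_nat d * (z * z ^ (d - 1)) = (of_nat d * z ^ d :: int fls)"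
    by (cases d) simp_all
  have "(1 + X\<^sup>2) * (fls_deriv (X ^ (n + 1) * 2 ^ e * z ^ d) - Y * (X ^ (n + 1) * 2 ^ e * z ^ d))
      = X\<^sup>2 * z * (of_nat (n + 1) * X ^ n * 2 ^ e * z ^ d - (X * Y) * X ^ n * 2 ^ e * z ^ d)
        - 2 * X ^ (n + 3) * 2 ^ e * Y ^ 3 * (of_nat d * (z * z ^ (d - 1)))"
    unfolding expand zX by (simp add: algebra_simps power_add power2_eq_square power3_eq_cube)
  also have "\<dots> = of_nat n * (X ^ (n + 2) * 2 ^ e * z ^ (d + 1))
        - 2 * (X * Y) * X ^ (n + 2) * 2 ^ e * Y\<^sup>2 * (of_nat d * z ^ d)"
    unfolding zd XY by (simp add: algebra_simps power_add power2_eq_square power3_eq_cube XY)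
  also have "\<dots> = of_nat d * (X ^ (n + 2) * 2 ^ (e + 1) * z ^ d) +
      (of_nat n - 2 * of_nat d) * (X ^ (n + 2) * 2 ^ e * z ^ (d + 1))"
    unfolding XY by (simp add: z_def algebra_simps)
  finally show ?thesis
    by (simp add: insert_max_def X_def Y_def z_def)
qed

section \<open>From the insertion recurrences to those of V\<close>

text \<open>
  The value of \<open>b\<close> at \<open>m < n\<close> is given by insertion of the largest letter, that of \<open>d\<close> by appending a last
  letter; the proof derives the difference equation \<open>b_diff\<close>, which alone is missing from the recurrences
  of \<open>V\<close>, by applying \<^const>\<open>insert_max\<close> to the equation for \<open>n - 1\<close>.
\<close>

lemma V_eq_by_recurrences:
  fixes b d :: "nat \<Rightarrow> int \<Rightarrow> int fls"
  assumes b_insert: "\<And>n m. 1 \<le> m \<Longrightarrow> m < int n \<Longrightarrow> b n m = insert_max (b (n - 1) m)"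
    and d_1: "d 1 1 = 1"
    and d_append: "\<And>n m. 2 \<le> n \<Longrightarrow> 1 \<le> m \<Longrightarrow> m \<le> int n \<Longrightarrow>
      d n m = fls_X_inv * (\<Sum>j\<in>{1..<m}. b (n - 1) j)"
    and b_max: "\<And>n. 1 \<le> n \<Longrightarrow> b n (int n) = fls_X\<^sup>2 * d n (int n)"
    and "1 \<le> k" "k \<le> n"
  shows "V n (int k) = b n (int n - int k + 1) \<and> V n (- int k) = d n (int n - int k + 1)"
proof -
  note XY = fls_X_times_X_inv [where 'a = int]
  have X_d: "fls_X * d n m = (\<Sum>j\<in>{1..<m}. b (n - 1) j)" if "2 \<le> n" "1 \<le> m" "m \<le> int n" for n m
    using d_append [OF that] by (simp add: XY flip: mult.assoc)
  have d_insert: "fls_X * d n m = insert_max (fls_X * d (n - 1) m)"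
    if "2 \<le> n" "1 \<le> m" "m < int n" for n m
  proof (cases "n = 2")
    case True
    with that have "m = 1"
      by simp
    with True show ?thesis
      by (simp add: X_d d_1 [unfolded One_nat_def] insert_max_X)
  next
    case False
    have "fls_X * d n m = (\<Sum>j\<in>{1..<m}. insert_max (b (n - 1 - 1) j))"
      using that by (subst X_d) (simp_all, intro sum.cong refl, subst b_insert, auto)
    also have "\<dots> = insert_max (fls_X * d (n - 1) m)"
      using that False by (subst X_d) (auto simp: insert_max_sum)
    finally show ?thesis .
  qed
  have b_diff: "b n m - b n (m + 1) = fls_X * d (n - 1) m" if "1 \<le> m" "m < int n" for n m
    using that
  proof (induction n)
    case (Suc n)
    show ?case
    proof (cases "m = int n")
      case False
      then have "b (Suc n) m - b (Suc n) (m + 1) = insert_max (b n m - b n (m + 1))"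
        using Suc.prems by (simp add: b_insert insert_max_diff)
      also have "\<dots> = fls_X * d n m"
        using Suc False d_insert [of n m] by simp
      finally show ?thesis
        by simp
    next
      case True
      have n: "1 \<le> n"
        using Suc.prems True by simp
      define S where "S = fls_X * d n (int n)"
      have bn: "b n (int n) = fls_X * S"
        using b_max [OF n] by (simp add: S_def power2_eq_square mult.assoc)
      (* With S = t d(n,n), the two terms of the difference are Lambda(t S) and t (Lambda S + t S), which
         leaves (1 + t^2) S - t^2 S = S. *)
      have low: "(\<Sum>j\<in>{1..<int n}. b n j) = insert_max S"
      proof (cases "n = 1")
        case True
        then show ?thesis
          by (simp add: S_def d_1 [unfolded One_nat_def] insert_max_X)
      next
        case False
        with n have "S = (\<Sum>j\<in>{1..<int n}. b (n - 1) j)"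
          by (simp add: S_def X_d)
        then show ?thesis
          by (simp add: insert_max_sum) (auto intro!: sum.cong b_insert [unfolded One_nat_def])
      qed
      have "b (Suc n) (int n) = insert_max (fls_X * S)"
        using n by (simp add: b_insert bn)
      moreover have "b (Suc n) (int n + 1) = fls_X * (insert_max S + fls_X * S)"
      proof -
        have "b (Suc n) (int n + 1) = fls_X * (fls_X * d (Suc n) (int n + 1))"
          using b_max [of "Suc n"] by (simp add: power2_eq_square mult.assoc add.commute)
        also have "fls_X * d (Suc n) (int n + 1) = (\<Sum>j\<in>{1..<int n + 1}. b n j)"
          using n by (simp add: X_d)
        also have "{1..<int n + 1} = insert (int n) {1..<int n}"
          using n by auto
        finally show ?thesis
          by (simp add: low bn add.commute)
      qed
      ultimately show ?thesis
        using True by (simp add: insert_max_X_mult S_def [symmetric])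
          (simp add: algebra_simps power2_eq_square)
    qed
  qed simp
  have d_bottom: "d n 1 = 0" if "2 \<le> n" for n
    using d_append [of n 1] that by simp
  have d_step: "d n (m + 1) = d n m + fls_X_inv * b (n - 1) m" if "1 \<le> m" "m < int n" for n m
  proof -
    have "{1..<m + 1} = insert m {1..<m}"
      using that by auto
    then show ?thesis
      using that by (simp add: d_append algebra_simps)
  qed
  show ?thesis
    using \<open>1 \<le> k\<close> \<open>k \<le> n\<close>
  proof (induction n arbitrary: k)
    case (Suc n)
    show ?case
    proof (cases "n = 0")
      case True
      with Suc.prems have "k = 1"
        by simp
      with True b_max [of 1] show ?thesis
        using V_1_pos V_1_neg d_1 by simp
    next
      case False
      then have n: "2 \<le> Suc n"
        by simp
      note IH = Suc.IH
      have neg: "V (Suc n) (- int k) = d (Suc n) (int (Suc n) - int k + 1)"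
        if "1 \<le> k" "k \<le> Suc n" for k
        using that(2)
      proof (induction rule: inc_induct)
        case base
        show ?case
          using V_neg_n [OF n] d_bottom [OF n] by simp
      next
        case (step l)
        then have *: "V (Suc n) (- int (Suc l)) = d (Suc n) (int (Suc n) - int (Suc l) + 1)"
          by simp
        have "V (Suc n) (- int l) = V (Suc n) (- int l - 1) + fls_X_inv * V n (int l)"
          using V_neg [of l "Suc n"] step that(1) by simp
        also have "- int l - 1 = - int (Suc l)"
          by simp
        also have "V n (int l) = b n (int n - int l + 1)"
          using Suc.IH [of l] step that(1) by simp
        finally show ?case
          using d_step [of "int n - int l + 1" "Suc n"] step * that(1)
          by (simp add: algebra_simps)
      qed
      have pos: "V (Suc n) (int k) = b (Suc n) (int (Suc n) - int k + 1)"
        if "1 \<le> k" "k \<le> Suc n" for k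
        using that
      proof (induction k rule: nat_induct_at_least)
        case base
        show ?case
          using V_one [OF n] neg [of 1] b_max [of "Suc n"] by (simp add: add.commute)
      next
        case (Suc k)
        then have *: "V (Suc n) (int k) = b (Suc n) (int (Suc n) - int k + 1)"
          by simp
        have "V (Suc n) (int (Suc k)) = V (Suc n) (int k) + fls_X * V n (- int k)"
          using V_pos [of "Suc k" "Suc n"] Suc.hyps Suc.prems by simp
        also have "V n (- int k) = d n (int n - int k + 1)"
          using Suc.prems Suc.hyps IH [of k] by simp
        finally show ?case
          using b_diff [of "int n - int k + 1" "Suc n"] Suc.hyps Suc.prems *
          by (simp add: algebra_simps)
      qed
      show ?thesis
        using neg pos Suc.prems by blast
    qed
  qed simp
qed

section \<open>Descents and right-to-left minima under insertion of the largest letter\<close>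

definition descents :: "'a::linorder list \<Rightarrow> nat set" where
  "descents w = {i. Suc i < length w \<and> w ! Suc i < w ! i}"

text \<open>
  The positions that do not carry a right-to-left minimum: these are the positions of free sign in type B.
\<close>

definition nonminima :: "'a::linorder list \<Rightarrow> nat set" where
  "nonminima w = {i. \<exists>j<length w. i < j \<and> w ! j < w ! i}"

lemma descents_subset_nonminima: "descents w \<subseteq> nonminima w"
  by (auto simp: descents_def nonminima_def)

lemma nonminima_subset: "nonminima w \<subseteq> {..<length w}"
  by (auto simp: nonminima_def)

lemma finite_nonminima [simp]: "finite (nonminima w)"
  by (rule finite_subset [OF nonminima_subset]) simp

lemma finite_descents [simp]: "finite (descents w)"
  by (rule finite_subset [OF descents_subset_nonminima]) simp

lemma descents_Nil [simp]: "descents [] = {}"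
  by (simp add: descents_def)

lemma nonminima_Nil [simp]: "nonminima [] = {}"
  by (simp add: nonminima_def)

lemma descents_Cons:
  "descents (a # w) = (if w \<noteq> [] \<and> hd w < a then {0} else {}) \<union> Suc ` descents w"
proof (rule set_eqI)
  fix i
  show "i \<in> descents (a # w) \<longleftrightarrow>
      i \<in> (if w \<noteq> [] \<and> hd w < a then {0} else {}) \<union> Suc ` descents w"
    by (cases i) (auto simp: descents_def hd_conv_nth)
qed

lemma nonminima_Cons:
  "nonminima (a # w) = (if \<exists>b\<in>set w. b < a then {0} else {}) \<union> Suc ` nonminima w"
proof (rule set_eqI)
  fix i
  have ex: "(\<exists>j<length (a # w). i < j \<and> P ((a # w) ! j)) \<longleftrightarrow> (\<exists>j<length w. i < Suc j \<and> P (w ! j))"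
    for P
    by (metis Suc_less_eq gr_implies_not_zero length_Cons not0_implies_Suc nth_Cons_Suc)
  have *: "i \<in> nonminima (a # w) \<longleftrightarrow> (\<exists>j<length w. i < Suc j \<and> w ! j < (a # w) ! i)"
    unfolding nonminima_def using ex [of "\<lambda>b. b < (a # w) ! i"] by simp
  show "i \<in> nonminima (a # w) \<longleftrightarrow>
      i \<in> (if \<exists>b\<in>set w. b < a then {0} else {}) \<union> Suc ` nonminima w"
  proof (cases i)
    case 0
    have "(\<exists>b\<in>set w. b < a) \<longleftrightarrow> (\<exists>j<length w. w ! j < a)"
      by (metis in_set_conv_nth)
    with 0 * show ?thesis
      by auto
  qed (use * in \<open>auto simp: nonminima_def\<close>)
qed

lemma card_descents_Cons:
  "card (descents (a # w)) = (if w \<noteq> [] \<and> hd w < a then 1 else 0) + card (descents w)"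
  by (auto simp: descents_Cons card_image card_insert_if)

lemma card_nonminima_Cons:
  "card (nonminima (a # w)) = (if \<exists>b\<in>set w. b < a then 1 else 0) + card (nonminima w)"
  by (auto simp: nonminima_Cons card_image card_insert_if)

lemma card_descents_append:
  "card (descents (u @ v)) = card (descents u) + card (descents v) +
     (if u \<noteq> [] \<and> v \<noteq> [] \<and> hd v < last u then 1 else 0)"
proof (induction u)
  case (Cons a u)
  then show ?case
    by (cases u) (auto simp: card_descents_Cons)
qed simp

definition insert_at :: "nat \<Rightarrow> 'a \<Rightarrow> 'a list \<Rightarrow> 'a list" where
  "insert_at i x w = take i w @ x # drop i w"

lemma length_insert_at [simp]: "length (insert_at i x w) = Suc (length w)"
  by (simp add: insert_at_def)

lemma set_insert_at [simp]: "set (insert_at i x w) = insert x (set w)"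
proof -
  have "set (u @ x # v) = insert x (set (u @ v))" for u v
    by simp
  from this [of "take i w" "drop i w"] show ?thesis
    by (simp only: insert_at_def append_take_drop_id)
qed

lemma distinct_insert_at:
  assumes "x \<notin> set w"
  shows "distinct (insert_at i x w) \<longleftrightarrow> distinct w"
proof -
  have "distinct (u @ x # v) \<longleftrightarrow> distinct (u @ v)" if "x \<notin> set (u @ v)" for u v
    using that by auto
  from this [of "take i w" "drop i w"] assms show ?thesis
    unfolding insert_at_def append_take_drop_id by blast
qed

text \<open>
  Inserted in front of position \<open>i\<close>, the largest letter \<open>x\<close> creates a descent.  If \<open>i\<close> is the bottom
  of a descent, that is \<open>i - 1\<close> is in \<^const>\<open>descents\<close>, this descent is lost at the same time.
\<close>

lemma card_descents_insert_at:
  assumes "i < length w" and max: "\<And>y. y \<in> set w \<Longrightarrow> y < x"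
  shows "card (descents (insert_at i x w)) = card (descents w) + (if i \<in> Suc ` descents w then 0 else 1)"
proof -
  define u v where "u = take i w" and "v = drop i w"
  have w: "w = u @ v" and v: "v \<noteq> []" and i: "i = length u"
    using assms by (auto simp: u_def v_def)
  have "hd v < x"
    using v max [of "hd v"] by (simp add: w)
  moreover have "u = [] \<or> \<not> x < last u"
    using max [of "last u"] by (cases "u = []") (auto simp: w not_less)
  ultimately have "card (descents (u @ x # v)) = card (descents u) + card (descents v) + 1"
    using v by (simp add: card_descents_append card_descents_Cons)
  moreover have "i \<in> Suc ` descents w \<longleftrightarrow> u \<noteq> [] \<and> v \<noteq> [] \<and> hd v < last u"
    using v by (cases u rule: rev_cases)
      (auto simp: w i descents_def nth_append hd_conv_nth image_iff)
  ultimately show ?thesis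
    by (auto simp: insert_at_def w card_descents_append i)
qed

lemma card_nonminima_insert_at:
  assumes "i < length w" and max: "\<And>y. y \<in> set w \<Longrightarrow> y < x"
  shows "card (nonminima (insert_at i x w)) = card (nonminima w) + 1"
proof -
  have "card (nonminima (u @ x # v)) = card (nonminima (u @ v)) + 1"
    if "v \<noteq> []" "\<And>y. y \<in> set (u @ v) \<Longrightarrow> y < x" for u v
    using that(2)
  proof (induction u)
    case Nil
    then show ?case
      using that(1) by (cases v) (auto simp: card_nonminima_Cons)
  next
    case (Cons a u)
    have "\<not> x < a"
      using Cons.prems [of a] by auto
    then have "(\<exists>b\<in>set (u @ x # v). b < a) \<longleftrightarrow> (\<exists>b\<in>set (u @ v). b < a)"
      by auto
    then show ?case
      using Cons by (simp only: append_Cons card_nonminima_Cons) simp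
  qed
  from this [of "drop i w" "take i w"] show ?thesis
    using assms by (simp add: insert_at_def)
qed

lemma has_double_descent_iff: "has_double_descent w \<longleftrightarrow> (\<exists>i\<in>descents w. Suc i \<in> descents w)"
  unfolding has_double_descent_def descents_def by (simp add: Bex_def) (metis Suc_lessD)

lemma has_double_descent_Cons:
  "has_double_descent (a # w) \<longleftrightarrow>
     0 \<in> descents (a # w) \<and> 0 \<in> descents w \<or> has_double_descent w"
  unfolding has_double_descent_iff by (auto simp: descents_Cons split: if_splits)

text \<open>
  The only way in which a largest letter \<open>x\<close> can take part in a double descent is as its top, and then the
  two letters after it form a descent.
\<close>

lemma has_double_descent_insert_at:
  assumes "\<not> has_double_descent w" and max: "\<And>y. y \<in> set w \<Longrightarrow> y < x"
  shows "has_double_descent (insert_at i x w) \<longleftrightarrow> i \<in> descents w"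
proof -
  have *: "has_double_descent (u @ x # v) \<longleftrightarrow> 0 \<in> descents v"
    if "\<not> has_double_descent (u @ v)" "\<And>y. y \<in> set (u @ v) \<Longrightarrow> y < x" for u v
    using that
  proof (induction u)
    case Nil
    then show ?case
      by (cases v) (auto simp: has_double_descent_Cons descents_Cons)
  next
    case (Cons a u)
    have "\<not> x < a"
      using Cons.prems(2) [of a] by auto
    moreover have "\<not> x < b" if "b \<in> set u" for b
      using Cons.prems(2) [of b] that by auto
    ultimately have "\<not> (0 \<in> descents (a # u @ x # v) \<and> 0 \<in> descents (u @ x # v))"
      using Cons.prems(1)
      by (cases u rule: list.exhaust; cases "tl u")
        (auto simp: has_double_descent_Cons descents_Cons split: if_splits)
    then show ?case
      using Cons by (auto simp: has_double_descent_Cons)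
  qed
  have "0 \<in> descents (drop i w) \<longleftrightarrow> i \<in> descents w"
    by (auto simp: descents_def)
  then show ?thesis
    using * [of "take i w" "drop i w"] assms by (simp add: insert_at_def)
qed

text \<open>
  The sum of \<open>t\<^sup>n\<^sup>+\<^sup>1\<^sup>-\<^sup>2\<^sup>p\<close> over all choices of signs at the \<^const>\<open>nonminima\<close> of a word of length \<open>n\<close>, where
  \<open>p\<close> is the number of descents with negative top: a sign at a descent contributes the factor
  \<open>1 + t\<^sup>-\<^sup>2\<close>, any other free sign the factor \<open>2\<close>.
\<close>

definition word_weight :: "int list \<Rightarrow> int fls" where
  "word_weight w = fls_X ^ (length w + 1) * 2 ^ card (nonminima w - descents w) *
     (1 + fls_X_inv\<^sup>2) ^ card (descents w)"

lemma card_nonminima_minus_descents: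
  "card (nonminima w - descents w) = card (nonminima w) - card (descents w)"
  by (simp add: card_Diff_subset descents_subset_nonminima)

text \<open>
  Without double descents, the set \<open>A\<close> of descent bottoms is disjoint from the forbidden positions, which
  are the descents.  The \<open>d\<close> positions of \<open>A\<close> and the remaining \<open>n - 2d\<close> positions \<open>B\<close> give the two
  terms of \<open>insert_max_weight\<close>.
\<close>

lemma sum_word_weight_insert_at:
  assumes dd: "\<not> has_double_descent w" and max: "\<And>y. y \<in> set w \<Longrightarrow> y < x"
  shows "(\<Sum>i\<in>{..<length w} - descents w. word_weight (insert_at i x w)) = insert_max (word_weight w)"
proof -
  define n d e where "n = length w" and "d = card (descents w)"
    and "e = card (nonminima w - descents w)"
  define A where "A = Suc ` descents w"
  define B where "B = {..<n} - (descents w \<union> A)"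
  have disj: "descents w \<inter> A = {}"
    using dd by (auto simp: A_def has_double_descent_iff)
  have sub: "descents w \<union> A \<subseteq> {..<n}"
    by (auto simp: A_def descents_def n_def)
  have cardA: "card A = d"
    by (simp add: A_def d_def card_image)
  have union: "card (descents w \<union> A) = 2 * d"
    using disj cardA by (simp add: card_Un_disjoint d_def A_def)
  have "2 * d \<le> n"
    using card_mono [OF _ sub] union by simp
  moreover have "card B = n - 2 * d"
    unfolding B_def using sub union by (simp add: card_Diff_subset A_def)
  ultimately have cardB: "(of_nat (card B) :: int fls) = of_nat n - 2 * of_nat d"
    by simp
  have e: "card (nonminima w) = e + d"
    using card_mono [OF _ descents_subset_nonminima, of w]
    by (simp add: e_def d_def card_nonminima_minus_descents)
  have wA: "word_weight (insert_at i x w) = fls_X ^ (n + 2) * 2 ^ (e + 1) * (1 + fls_X_inv\<^sup>2) ^ d"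
    if "i \<in> A" for i
  proof -
    have "i < length w"
      using that sub by (auto simp: n_def)
    then show ?thesis
      using that max
      by (simp add: word_weight_def card_nonminima_minus_descents card_descents_insert_at
          card_nonminima_insert_at e A_def flip: n_def d_def)
  qed
  have wB: "word_weight (insert_at i x w) = fls_X ^ (n + 2) * 2 ^ e * (1 + fls_X_inv\<^sup>2) ^ (d + 1)"
    if "i \<in> B" for i
  proof -
    have "i < length w"
      using that by (auto simp: n_def B_def)
    then show ?thesis
      using that max
      by (simp add: word_weight_def card_nonminima_minus_descents card_descents_insert_at
          card_nonminima_insert_at e A_def B_def flip: n_def d_def)
  qed
  have "{..<length w} - descents w = A \<union> B"
    using sub disj by (auto simp: B_def n_def)
  moreover have "finite A" "finite B" "A \<inter> B = {}"
    by (auto simp: A_def B_def)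
  ultimately have "(\<Sum>i\<in>{..<length w} - descents w. word_weight (insert_at i x w)) =
      (\<Sum>i\<in>A. word_weight (insert_at i x w)) + (\<Sum>i\<in>B. word_weight (insert_at i x w))"
    by (simp add: sum.union_disjoint)
  also have "\<dots> = insert_max (fls_X ^ (n + 1) * 2 ^ e * (1 + fls_X_inv\<^sup>2) ^ d)"
    unfolding insert_max_weight using cardA cardB by (simp add: wA wB)
  finally show ?thesis
    by (simp add: word_weight_def n_def d_def e_def)
qed

section \<open>Simsun words\<close>

text \<open>
  The bound \<open>k\<close> ranges over all integers instead of \<open>{1..n}\<close>, so that the notion does not depend on the set
  of letters and is preserved by shifting them.
\<close>

definition simsun_word :: "int list \<Rightarrow> bool" where
  "simsun_word w \<longleftrightarrow> (\<forall>k. \<not> has_double_descent (filter (\<lambda>x. x \<le> k) w))"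

lemma simsun_word_no_double_descent:
  assumes "simsun_word w"
  shows "\<not> has_double_descent w"
proof -
  have "filter (\<lambda>x. x \<le> Max (insert 0 (set w))) w = w"
    by (simp add: filter_id_conv)
  then show ?thesis
    using assms unfolding simsun_word_def by metis
qed

lemma simsun_iff: "w \<in> simsun n \<longleftrightarrow> w \<in> permutations_of_set {1..int n} \<and> simsun_word w"
proof -
  have "\<not> has_double_descent (filter (\<lambda>x. x \<le> k) w)"
    if w: "set w = {1..int n}" and ss: "\<forall>k\<in>{1..int n}. \<not> has_double_descent (filter (\<lambda>x. x \<le> k) w)" for k
  proof -
    consider "k < 1" | "k \<in> {1..int n}" | "1 \<le> int n" "int n < k" | "n = 0"
      by force
    then show ?thesis
    proof cases
      case 1
      then have "filter (\<lambda>x. x \<le> k) w = []"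
        using w by (auto simp: filter_empty_conv)
      then show ?thesis
        by (simp add: has_double_descent_iff)
    next
      case 3
      then have "filter (\<lambda>x. x \<le> k) w = filter (\<lambda>x. x \<le> int n) w"
        using w by (intro filter_cong) auto
      then show ?thesis
        using ss 3 by simp
    qed (use w ss in \<open>auto simp: has_double_descent_iff\<close>)
  qed
  then show ?thesis
    by (auto simp: simsun_def simsun_word_def permutations_of_set_def)
qed

text \<open>
  Removing the letters above \<open>k < x\<close> removes \<open>x\<close> too, hence the only new condition concerns the full word.
\<close>

lemma simsun_word_insert_at_iff:
  assumes max: "\<And>y. y \<in> set w \<Longrightarrow> y < x"
  shows "simsun_word (insert_at i x w) \<longleftrightarrow> simsun_word w \<and> i \<notin> descents w"
proof -
  have low: "filter (\<lambda>y. y \<le> k) (insert_at i x w) = filter (\<lambda>y. y \<le> k) w" if "k < x" for k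
  proof -
    have "filter (\<lambda>y. y \<le> k) (u @ x # v) = filter (\<lambda>y. y \<le> k) (u @ v)" for u v
      using that by simp
    from this [of "take i w" "drop i w"] show ?thesis
      by (simp only: insert_at_def append_take_drop_id)
  qed
  have high: "filter (\<lambda>y. y \<le> k) (insert_at i x w) = insert_at i x w" if "x \<le> k" for k
    using that max by (force intro: filter_True)
  show ?thesis
  proof (cases "simsun_word w")
    case True
    then have dd: "has_double_descent (insert_at i x w) \<longleftrightarrow> i \<in> descents w"
      using max by (intro has_double_descent_insert_at simsun_word_no_double_descent)
    have "\<not> has_double_descent (filter (\<lambda>y. y \<le> k) (insert_at i x w))"
      if "i \<notin> descents w" for k
      using True that dd low [of k] high [of k] unfolding simsun_word_def by (cases "k < x") auto
    then show ?thesis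
      using True dd simsun_word_no_double_descent [of "insert_at i x w"]
      unfolding simsun_word_def by blast
  next
    case False
    then obtain k where k: "has_double_descent (filter (\<lambda>y. y \<le> k) w)"
      by (auto simp: simsun_word_def)
    have "filter (\<lambda>y. y \<le> min k (x - 1)) w = filter (\<lambda>y. y \<le> k) w"
      using max by (intro filter_cong) force+
    then have "has_double_descent (filter (\<lambda>y. y \<le> min k (x - 1)) (insert_at i x w))"
      using k by (subst low) simp_all
    with False show ?thesis
      unfolding simsun_word_def by blast
  qed
qed

lemma set_simsun: "w \<in> simsun n \<Longrightarrow> set w = {1..int n}"
  and distinct_simsun: "w \<in> simsun n \<Longrightarrow> distinct w"
  by (simp_all add: simsun_iff permutations_of_set_def)

lemma length_simsun:
  assumes "w \<in> simsun n"
  shows "length w = n"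
  using distinct_card [OF distinct_simsun [OF assms]] set_simsun [OF assms] by simp

lemma finite_simsun [simp]: "finite (simsun n)"
  by (rule finite_subset [of _ "permutations_of_set {1..int n}"]) (auto simp: simsun_iff)

lemma insert_at_in_simsun_iff:
  assumes "set w = {1..int n}"
  shows "insert_at i (int (Suc n)) w \<in> simsun (Suc n) \<longleftrightarrow> w \<in> simsun n \<and> i \<notin> descents w"
proof -
  have "insert (int (Suc n)) {1..int n} = {1..int (Suc n)}"
    by auto
  then have "set (insert_at i (int (Suc n)) w) = {1..int (Suc n)}"
    by (simp only: set_insert_at assms)
  moreover have "distinct (insert_at i (int (Suc n)) w) \<longleftrightarrow> distinct w"
    using assms by (intro distinct_insert_at) simp
  moreover have "simsun_word (insert_at i (int (Suc n)) w) \<longleftrightarrow> simsun_word w \<and> i \<notin> descents w"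
    using assms by (intro simsun_word_insert_at_iff) auto
  ultimately show ?thesis
    using assms unfolding simsun_iff permutations_of_set_def by blast
qed

lemma remove1_insert_at: "x \<notin> set w \<Longrightarrow> remove1 x (insert_at i x w) = w"
  using in_set_takeD [of x i w] by (auto simp: insert_at_def remove1_append)

lemma takeWhile_insert_at:
  assumes "x \<notin> set w"
  shows "takeWhile (\<lambda>y. y \<noteq> x) (insert_at i x w) = take i w"
proof -
  have "\<forall>y\<in>set (take i w). y \<noteq> x"
    using assms in_set_takeD by fastforce
  then show ?thesis
    by (simp add: insert_at_def)
qed

lemma insert_at_index_inj:
  assumes "x \<notin> set w" "i \<le> length w" "j \<le> length w" "insert_at i x w = insert_at j x w"
  shows "i = j"
proof -
  have "take i w = take j w"
    unfolding takeWhile_insert_at [OF assms(1), symmetric] assms(4) ..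
  then have "length (take i w) = length (take j w)"
    by (rule arg_cong)
  then show ?thesis
    using assms(2,3) by simp
qed

lemma last_insert_at: "i < length w \<Longrightarrow> last (insert_at i x w) = last w"
  by (simp add: insert_at_def)

text \<open>
  A last letter \<open>m \<le> n\<close> forces the new letter \<open>n + 1\<close> away from the end, so that deleting it keeps the last
  letter.
\<close>

lemma bij_betw_insert_at_simsun:
  assumes "m \<le> int n"
  shows "bij_betw (\<lambda>(w, i). insert_at i (int (Suc n)) w)
    (SIGMA w:{w \<in> simsun n. last w = m}. {..<n} - descents w)
    {w \<in> simsun (Suc n). last w = m}" (is "bij_betw ?f ?A ?B")
proof (rule bij_betw_imageI)
  have notin: "int (Suc n) \<notin> set w" if "w \<in> simsun n" for w
    using set_simsun [OF that] by auto
  show "inj_on ?f ?A"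
  proof (rule inj_onI, clarsimp)
    fix w i w' i'
    assume w: "w \<in> simsun n" "w' \<in> simsun n" and i: "i < n" "i' < n"
      and eq: "insert_at i (1 + int n) w = insert_at i' (1 + int n) w'"
    have "w = w'"
      using arg_cong [OF eq, of "remove1 (1 + int n)"] w notin by (simp add: remove1_insert_at)
    with eq w i notin show "w = w' \<and> i = i'"
      using insert_at_index_inj [of "1 + int n" w i i'] by (simp add: length_simsun)
  qed
  show "?f ` ?A = ?B"
  proof (intro subset_antisym subsetI)
    fix x assume "x \<in> ?f ` ?A"
    then obtain w i where x: "x = insert_at i (int (Suc n)) w"
      and w: "w \<in> simsun n" "last w = m" "i < n" "i \<notin> descents w"
      by auto
    have "x \<in> simsun (Suc n)"
      using w by (subst x, subst insert_at_in_simsun_iff [OF set_simsun [OF w(1)]]) simp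
    then show "x \<in> ?B"
      using x w by (simp add: last_insert_at length_simsun)
  next
    fix x assume "x \<in> ?B"
    then have x: "x \<in> simsun (Suc n)" and m: "last x = m"
      by simp_all
    have "int (Suc n) \<in> set x"
      using set_simsun [OF x] by simp
    then obtain u v where uv: "x = u @ int (Suc n) # v"
      by (meson split_list)
    have v: "v \<noteq> []"
      using m assms uv by auto
    define w where "w = u @ v"
    have xw: "x = insert_at (length u) (int (Suc n)) w"
      by (simp add: insert_at_def w_def uv)
    have "int (Suc n) \<notin> set w"
      using distinct_simsun [OF x] by (auto simp: w_def uv)
    moreover have "insert (int (Suc n)) (set w) = {1..int (Suc n)}"
      using set_simsun [OF x] unfolding xw by simp
    ultimately have "set w = {1..int (Suc n)} - {int (Suc n)}"
      by blast
    also have "\<dots> = {1..int n}"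
      by auto
    finally have "w \<in> simsun n" "length u \<notin> descents w"
      using x insert_at_in_simsun_iff [of w n "length u"] unfolding xw by blast+
    moreover have "length u < n"
      using length_simsun [OF \<open>w \<in> simsun n\<close>] v by (cases v) (auto simp: w_def)
    moreover have "last w = last x"
      using v by (simp add: w_def uv)
    ultimately have "(w, length u) \<in> ?A"
      using m by simp
    then show "x \<in> ?f ` ?A"
      using xw by (intro image_eqI [of _ _ "(w, length u)"]) simp_all
  qed
qed

definition simsun_sum :: "nat \<Rightarrow> int \<Rightarrow> int fls" where
  "simsun_sum n m = (\<Sum>w\<in>{w \<in> simsun n. last w = m}. word_weight w)"

lemma simsun_sum_insert_max:
  assumes "1 \<le> m" "m < int n"
  shows "simsun_sum n m = insert_max (simsun_sum (n - 1) m)"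
proof (cases n)
  case (Suc p)
  have "simsun_sum n m = (\<Sum>(w, i)\<in>(SIGMA w:{w \<in> simsun p. last w = m}. {..<p} - descents w).
      word_weight (insert_at i (int (Suc p)) w))"
    unfolding simsun_sum_def Suc using assms Suc
    by (subst sum.reindex_bij_betw [OF bij_betw_insert_at_simsun, symmetric])
      (auto simp: case_prod_unfold)
  also have "\<dots> = (\<Sum>w\<in>{w \<in> simsun p. last w = m}. \<Sum>i\<in>{..<p} - descents w.
      word_weight (insert_at i (int (Suc p)) w))"
    by (subst sum.Sigma) auto
  also have "\<dots> = (\<Sum>w\<in>{w \<in> simsun p. last w = m}. insert_max (word_weight w))"
  proof (rule sum.cong [OF refl])
    fix w assume "w \<in> {w \<in> simsun p. last w = m}"
    then have w: "w \<in> simsun p"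
      by simp
    then have "\<not> has_double_descent w"
      by (simp add: simsun_iff simsun_word_no_double_descent)
    from sum_word_weight_insert_at [OF this, of "int (Suc p)"]
    show "(\<Sum>i\<in>{..<p} - descents w. word_weight (insert_at i (int (Suc p)) w)) =
        insert_max (word_weight w)"
      by (simp add: set_simsun [OF w] length_simsun [OF w])
  qed
  finally show ?thesis
    by (simp add: simsun_sum_def insert_max_sum Suc)
qed (use assms in simp)

section \<open>Appending a larger last letter\<close>

definition make_room :: "int \<Rightarrow> int \<Rightarrow> int" where
  "make_room m x = (if m \<le> x then x + 1 else x)"

lemma make_room_less_iff [simp]: "make_room m x < make_room m y \<longleftrightarrow> x < y"
  by (auto simp: make_room_def)

lemma make_room_inj: "inj (make_room m)"
  by (rule strict_mono_imp_inj_on) (simp add: strict_mono_def)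

lemma descents_map_make_room [simp]: "descents (map (make_room m) w) = descents w"
  by (auto simp: descents_def)

lemma nonminima_map_make_room [simp]: "nonminima (map (make_room m) w) = nonminima w"
  by (auto simp: nonminima_def)

text \<open>
  The letters of the shifted word that are at most \<open>k\<close> come from those that are at most \<open>g k\<close>, and every
  bound has the form \<open>g k\<close>.
\<close>

lemma simsun_word_map_make_room [simp]: "simsun_word (map (make_room m) w) \<longleftrightarrow> simsun_word w"
proof -
  have hdd: "has_double_descent (map (make_room m) v) \<longleftrightarrow> has_double_descent v" for v
    by (simp add: has_double_descent_iff)
  define g where "g k = (if m \<le> k then k - 1 else k)" for k
  have "make_room m x \<le> k \<longleftrightarrow> x \<le> g k" for x k
    by (auto simp: make_room_def g_def)
  then have filter: "filter (\<lambda>x. x \<le> k) (map (make_room m) w) =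
      map (make_room m) (filter (\<lambda>x. x \<le> g k) w)" for k
    by (simp add: filter_map o_def)
  have "surj g"
    by (rule surjI [of _ "make_room m"]) (auto simp: make_room_def g_def)
  then have "(\<forall>k. \<not> has_double_descent (filter (\<lambda>x. x \<le> g k) w)) \<longleftrightarrow>
      (\<forall>k. \<not> has_double_descent (filter (\<lambda>x. x \<le> k) w))"
    by (metis surj_def)
  then show ?thesis
    by (simp only: simsun_word_def filter hdd)
qed

lemma descents_snoc:
  assumes "w = [] \<or> last w < x"
  shows "descents (w @ [x]) = descents w"
proof (rule set_eqI)
  fix i
  consider "Suc i < length w" | "Suc i = length w" | "length w < Suc i"
    by linarith
  then show "i \<in> descents (w @ [x]) \<longleftrightarrow> i \<in> descents w"
  proof cases
    case 2
    then have "w \<noteq> []"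
      by auto
    moreover from this have "last w = w ! i"
      by (simp add: last_conv_nth flip: 2)
    ultimately have "\<not> x < w ! i"
      using assms by auto
    with 2 show ?thesis
      by (auto simp: descents_def nth_append)
  qed (auto simp: descents_def nth_append)
qed

lemma nonminima_snoc:
  assumes "\<And>y. y \<in> set w \<Longrightarrow> \<not> x < y"
  shows "nonminima (w @ [x]) = nonminima w"
proof (intro subset_antisym subsetI)
  fix i assume "i \<in> nonminima (w @ [x])"
  then obtain j where j: "j < Suc (length w)" "i < j" "(w @ [x]) ! j < (w @ [x]) ! i"
    by (auto simp: nonminima_def)
  then have "(w @ [x]) ! j < w ! i"
    by (simp add: nth_append)
  moreover from this have "j \<noteq> length w"
    using j assms [of "w ! i"] by auto
  ultimately show "i \<in> nonminima w"
    using j by (auto simp: nonminima_def nth_append intro!: exI [of _ j])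
next
  fix i assume "i \<in> nonminima w"
  then obtain j where "j < length w" "i < j" "w ! j < w ! i"
    by (auto simp: nonminima_def)
  then show "i \<in> nonminima (w @ [x])"
    by (auto simp: nonminima_def nth_append intro!: exI [of _ j])
qed

lemma has_double_descent_snoc:
  "w = [] \<or> last w < x \<Longrightarrow> has_double_descent (w @ [x]) \<longleftrightarrow> has_double_descent w"
  by (simp only: has_double_descent_iff descents_snoc)

text \<open>
  If the appended letter \<open>x\<close> survives the restriction to the letters up to \<open>k\<close>, then so does the last
  letter of \<open>w\<close>, which is smaller, and the restricted word still ends in an ascent.
\<close>

lemma simsun_word_snoc:
  assumes "w = [] \<or> last w < x"
  shows "simsun_word (w @ [x]) \<longleftrightarrow> simsun_word w"
proof
  assume R: "simsun_word w"
  show "simsun_word (w @ [x])"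
    unfolding simsun_word_def
  proof
    fix k
    have "filter (\<lambda>y. y \<le> k) w = [] \<or> last (filter (\<lambda>y. y \<le> k) w) < x" if "x \<le> k"
      using assms that by (cases w rule: rev_cases) auto
    then have "has_double_descent (filter (\<lambda>y. y \<le> k) (w @ [x])) \<longleftrightarrow>
        has_double_descent (filter (\<lambda>y. y \<le> k) w)"
      by (cases "x \<le> k") (simp_all add: has_double_descent_snoc)
    then show "\<not> has_double_descent (filter (\<lambda>y. y \<le> k) (w @ [x]))"
      using R unfolding simsun_word_def by blast
  qed
next
  assume L: "simsun_word (w @ [x])"
  have *: "has_double_descent (v @ [x])" if "has_double_descent v" for v
  proof -
    from that obtain i where "i + 2 < length v" "v ! i > v ! (i + 1)" "v ! (i + 1) > v ! (i + 2)"
      by (auto simp: has_double_descent_def)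
    then show ?thesis
      unfolding has_double_descent_def by (intro exI [of _ i]) (simp add: nth_append)
  qed
  show "simsun_word w"
    unfolding simsun_word_def
  proof
    fix k
    show "\<not> has_double_descent (filter (\<lambda>y. y \<le> k) w)"
      using L [unfolded simsun_word_def, rule_format, of k] * [of "filter (\<lambda>y. y \<le> k) w"]
      by (cases "x \<le> k") auto
  qed
qed

text \<open>
  By \<open>simsun_word_snoc\<close> a final ascent imposes no condition on the rest of the word, so any word with last
  letter below \<open>m\<close> occurs; a last letter below \<open>m\<close> is not moved by \<^const>\<open>make_room\<close>.
\<close>

lemma bij_betw_append_simsun:
  assumes "2 \<le> n" "1 \<le> m" "m \<le> int n"
  shows "bij_betw (\<lambda>w. map (make_room m) w @ [m]) {w \<in> simsun (n - 1). last w < m}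
    {w \<in> simsun n. last w = m \<and> last (butlast w) < m}" (is "bij_betw ?f ?A ?B")
proof (rule bij_betw_imageI)
  show "inj_on ?f ?A"
    using inj_map_eq_map [OF make_room_inj [of m]] unfolding inj_on_def append1_eq_conv by blast
  have nonempty: "w \<noteq> []" if "length w = n - 1" for w :: "int list"
    using that assms by auto
  have room: "make_room m ` {1..int (n - 1)} = {1..int n} - {m}"
  proof (intro subset_antisym subsetI)
    fix x assume x: "x \<in> {1..int n} - {m}"
    define y where "y = (if m < x then x - 1 else x)"
    have "x = make_room m y" "y \<in> {1..int (n - 1)}"
      using x assms by (auto simp: make_room_def y_def)
    then show "x \<in> make_room m ` {1..int (n - 1)}"
      by (rule image_eqI)
  next
    fix x assume "x \<in> make_room m ` {1..int (n - 1)}"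
    then obtain y where "x = make_room m y" "1 \<le> y" "y \<le> int n - 1"
      using assms by auto
    then show "x \<in> {1..int n} - {m}"
      by (simp add: make_room_def)
  qed
  have range: "set (map (make_room m) w) = {1..int n} - {m} \<longleftrightarrow> set w = {1..int (n - 1)}" for w
    unfolding room [symmetric] set_map using inj_image_eq_iff [OF make_room_inj] .
  have iff: "?f w \<in> ?B \<longleftrightarrow> w \<in> ?A" if "length w = n - 1" for w
  proof -
    have last: "last (map (make_room m) w) < m \<longleftrightarrow> last w < m"
      using nonempty [OF that] by (auto simp: last_map make_room_def)
    have insert_iff: "insert m S = I \<longleftrightarrow> S = I - {m}" if "m \<notin> S" "m \<in> I" for S I
      using that by auto
    have notin: "m \<notin> set (map (make_room m) w)"
      by (auto simp: make_room_def)
    have "distinct (?f w) \<longleftrightarrow> distinct w"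
      using notin inj_on_subset [OF make_room_inj subset_UNIV] by (simp add: distinct_map)
    moreover have "set (?f w) = {1..int n} \<longleftrightarrow> set w = {1..int (n - 1)}"
    proof -
      note notin
      moreover have "set (?f w) = insert m (set (map (make_room m) w))"
        by simp
      moreover have "m \<in> {1..int n}"
        using assms by simp
      ultimately have "set (?f w) = {1..int n} \<longleftrightarrow> set (map (make_room m) w) = {1..int n} - {m}"
        by (simp only: insert_iff not_False_eq_True)
      then show ?thesis
        by (simp only: range)
    qed
    ultimately show ?thesis
      using simsun_word_snoc [of "map (make_room m) w" m] last
      by (auto simp: simsun_iff permutations_of_set_def)
  qed
  show "?f ` ?A = ?B"
  proof (intro subset_antisym subsetI)
    fix x assume "x \<in> ?f ` ?A"
    then show "x \<in> ?B"
      using iff length_simsun by force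
  next
    fix x assume x: "x \<in> ?B"
    define v where "v = butlast x"
    have "length x = n" "distinct x"
      using x length_simsun distinct_simsun by auto
    then have xv: "x = v @ [m]" and len: "length v = n - 1"
      using assms x by (auto simp: v_def intro: append_butlast_last_id [symmetric])
    define w where "w = map (\<lambda>x. if m < x then x - 1 else x) v"
    have "m \<notin> set v"
      using \<open>distinct x\<close> xv by simp
    then have "map (make_room m) w = v"
      unfolding w_def map_map by (intro map_idI) (auto simp: make_room_def)
    then have fw: "x = ?f w"
      using xv by simp
    have "w \<in> ?A"
      using iff [of w] x len unfolding fw by (simp add: w_def)
    with fw show "x \<in> ?f ` ?A"
      by (rule image_eqI)
  qed
qed

lemma sum_butlast_weight:
  assumes "2 \<le> n" "1 \<le> m" "m \<le> int n"
  shows "(\<Sum>w\<in>{w \<in> simsun n. last w = m \<and> last (butlast w) < m}. word_weight (butlast w)) =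
    (\<Sum>j\<in>{1..<m}. simsun_sum (n - 1) j)"
proof -
  have "(\<Sum>w\<in>{w \<in> simsun n. last w = m \<and> last (butlast w) < m}. word_weight (butlast w)) =
      (\<Sum>w\<in>{w \<in> simsun (n - 1). last w < m}. word_weight w)"
    by (subst sum.reindex_bij_betw [OF bij_betw_append_simsun [OF assms], symmetric])
      (simp add: word_weight_def)
  also have "{w \<in> simsun (n - 1). last w < m} = (\<Union>j\<in>{1..<m}. {w \<in> simsun (n - 1). last w = j})"
  proof -
    have "1 \<le> last w" if "w \<in> simsun (n - 1)" for w
    proof -
      have "last w \<in> set w"
        using length_simsun [OF that] assms by (intro last_in_set) auto
      then show ?thesis
        using set_simsun [OF that] by simp
    qed
    then show ?thesis
      by auto
  qed
  also have "sum word_weight \<dots> = (\<Sum>j\<in>{1..<m}. simsun_sum (n - 1) j)"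
    unfolding simsun_sum_def by (intro sum.UNION_disjoint) auto
  finally show ?thesis .
qed

section \<open>Signed permutations as words with a set of negative positions\<close>

text \<open>
  The signed permutation whose absolute values are the letters of \<open>w\<close> and whose letters are negative
  precisely at the positions in \<open>S\<close>.  Positions are counted from \<open>0\<close> in words and from \<open>1\<close> in signed
  permutations.  Outside \<open>{\<plusminus>1, \<dots>, \<plusminus>n}\<close> it has to be the identity.
\<close>

definition signed_word :: "int list \<Rightarrow> nat set \<Rightarrow> int \<Rightarrow> int" where
  "signed_word w S i =
     (if 1 \<le> \<bar>i\<bar> \<and> \<bar>i\<bar> \<le> int (length w)
      then (if nat \<bar>i\<bar> - 1 \<in> S then - sgn i else sgn i) * w ! (nat \<bar>i\<bar> - 1) else i)"

lemma signed_word_minus: "signed_word w S (- i) = - signed_word w S i"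
  by (simp add: signed_word_def)

lemma signed_word_nth:
  "j < length w \<Longrightarrow> signed_word w S (int j + 1) = (if j \<in> S then - w ! j else w ! j)"
  by (simp add: signed_word_def nat_add_distrib)

definition neg_positions :: "nat \<Rightarrow> (int \<Rightarrow> int) \<Rightarrow> nat set" where
  "neg_positions n \<sigma> = {j. j < n \<and> \<sigma> (int j + 1) < 0}"

lemma length_abs_word [simp]: "length (abs_word n \<sigma>) = n"
  by (simp add: abs_word_def)

lemma nth_abs_word: "j < n \<Longrightarrow> abs_word n \<sigma> ! j = \<bar>\<sigma> (int j + 1)\<bar>"
  by (simp add: abs_word_def nth_upto add.commute)

context
  fixes n :: nat and w :: "int list"
  assumes w: "w \<in> permutations_of_set {1..int n}"
begin

lemma set_perm_word: "set w = {1..int n}"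
  and distinct_perm_word: "distinct w"
  using w by (simp_all add: permutations_of_set_def)

lemma length_perm_word: "length w = n"
  using distinct_card [OF distinct_perm_word] set_perm_word by simp

lemma nth_perm_word: "j < n \<Longrightarrow> 1 \<le> w ! j \<and> w ! j \<le> int n"
  using nth_mem [of j w] set_perm_word length_perm_word by simp

lemma abs_signed_word: "j < n \<Longrightarrow> \<bar>signed_word w S (int j + 1)\<bar> = w ! j"
  using nth_perm_word [of j] by (simp add: signed_word_nth length_perm_word)

lemma signed_word_neg_iff: "j < n \<Longrightarrow> signed_word w S (int j + 1) < 0 \<longleftrightarrow> j \<in> S"
  using nth_perm_word [of j] by (simp add: signed_word_nth length_perm_word)

lemma abs_word_signed_word: "abs_word n (signed_word w S) = w"
  by (rule nth_equalityI) (simp_all add: length_perm_word nth_abs_word abs_signed_word)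

lemma neg_positions_signed_word: "S \<subseteq> {..<n} \<Longrightarrow> neg_positions n (signed_word w S) = S"
  by (auto simp: neg_positions_def signed_word_neg_iff)

lemma nth_perm_word':
  assumes "1 \<le> \<bar>i\<bar>" "\<bar>i\<bar> \<le> int n"
  shows "1 \<le> w ! (nat \<bar>i\<bar> - 1) \<and> w ! (nat \<bar>i\<bar> - 1) \<le> int n"
  using assms by (intro nth_perm_word) linarith

lemma abs_signed_word':
  assumes "1 \<le> \<bar>i\<bar>" "\<bar>i\<bar> \<le> int n"
  shows "\<bar>signed_word w S i\<bar> = w ! (nat \<bar>i\<bar> - 1)"
proof -
  define c where "c = (if nat \<bar>i\<bar> - 1 \<in> S then - sgn i else sgn i)"
  define x where "x = w ! (nat \<bar>i\<bar> - 1)"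
  have "signed_word w S i = c * x"
    by (simp only: signed_word_def length_perm_word c_def x_def assms simp_thms if_True)
  moreover have "\<bar>c\<bar> = 1"
    using assms(1) by (cases "i = 0") (simp_all add: c_def abs_sgn_eq)
  moreover have "1 \<le> x"
    unfolding x_def using nth_perm_word' [OF assms] by blast
  ultimately show ?thesis
    unfolding x_def [symmetric] by (simp add: abs_mult)
qed

text \<open>
  Two arguments with the same image have the same absolute value because the letters of \<open>w\<close> are distinct;
  they cannot be opposite because the map is odd and has no zero on \<open>T\<close>.
\<close>

lemma signed_word_in_signed_perms: "signed_word w S \<in> signed_perms n"
proof -
  define T where "T = {- int n..-1} \<union> {1..int n}"
  have T: "i \<in> T \<longleftrightarrow> 1 \<le> \<bar>i\<bar> \<and> \<bar>i\<bar> \<le> int n" for i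
    by (auto simp: T_def)
  have abs: "\<bar>signed_word w S i\<bar> = w ! (nat \<bar>i\<bar> - 1)" if "i \<in> T" for i
    using that abs_signed_word' by (simp only: T)
  have range: "signed_word w S i \<in> T" if "i \<in> T" for i
    using nth_perm_word' [of i] that unfolding T abs [OF that] by blast
  have "inj_on (signed_word w S) T"
  proof (rule inj_onI)
    fix i j assume i: "i \<in> T" and j: "j \<in> T" and eq: "signed_word w S i = signed_word w S j"
    have "w ! (nat \<bar>i\<bar> - 1) = w ! (nat \<bar>j\<bar> - 1)"
      using abs [OF i] abs [OF j] by (simp only: eq)
    moreover have "nat \<bar>i\<bar> - 1 < length w" "nat \<bar>j\<bar> - 1 < length w"
      using i j unfolding T length_perm_word by linarith+
    ultimately have "nat \<bar>i\<bar> - 1 = nat \<bar>j\<bar> - 1"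
      using distinct_perm_word nth_eq_iff_index_eq by blast
    then have "\<bar>i\<bar> = \<bar>j\<bar>"
      using i j unfolding T by linarith
    moreover have "i \<noteq> - j"
    proof
      assume "i = - j"
      then have "signed_word w S j = 0"
        using eq signed_word_minus [of w S j] by simp
      then show False
        using range [OF j] by (simp add: T)
    qed
    ultimately show "i = j"
      by linarith
  qed
  moreover have "finite T"
    by (simp add: T_def)
  ultimately have "bij_betw (signed_word w S) T T"
    unfolding bij_betw_def using range endo_inj_surj by blast
  then have "signed_word w S permutes T"
  proof (rule bij_imp_permutes)
    fix i assume "i \<notin> T"
    then show "signed_word w S i = i"
      by (simp only: T signed_word_def length_perm_word if_False)
  qed
  then show ?thesis
    by (simp add: signed_perms_def signed_word_minus T_def)
qed

text \<open>
  The sign condition of type B is the case \<open>k = n\<close>, that of type D the case \<open>k = n - 1\<close>.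
\<close>

lemma minima_positive_iff:
  assumes "k \<le> n"
  shows "(\<forall>i\<in>{1..int k}. \<bar>signed_word w S i\<bar> = Min ((\<lambda>j. \<bar>signed_word w S j\<bar>) ` {i..int k}) \<longrightarrow>
      signed_word w S i > 0) \<longleftrightarrow> S \<inter> {..<k} \<subseteq> nonminima (take k w)"
proof -
  let ?s = "signed_word w S"
  have shift: "(\<lambda>j. int j + 1) ` {a..<k} = {int a + 1..int k}" for a
  proof (intro subset_antisym subsetI)
    fix i assume "i \<in> {int a + 1..int k}"
    then show "i \<in> (\<lambda>j. int j + 1) ` {a..<k}"
      by (intro image_eqI [of _ _ "nat (i - 1)"]) auto
  qed auto
  have img: "(\<lambda>j. \<bar>?s j\<bar>) ` {int a + 1..int k} = (!) w ` {a..<k}" for a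
    unfolding shift [symmetric] image_image
    using assms by (intro image_cong) (simp_all add: abs_signed_word)
  have step: "(\<bar>?s (int a + 1)\<bar> = Min ((\<lambda>j. \<bar>?s j\<bar>) ` {int a + 1..int k}) \<longrightarrow> ?s (int a + 1) > 0)
      \<longleftrightarrow> (a \<in> S \<longrightarrow> a \<in> nonminima (take k w))" if "a < k" for a
  proof -
    have a: "a < n"
      using that assms by simp
    have "w ! a = Min ((!) w ` {a..<k}) \<longleftrightarrow> (\<forall>l\<in>{a..<k}. w ! a \<le> w ! l)"
      using that by (subst eq_Min_iff) auto
    also have "(\<forall>l\<in>{a..<k}. w ! a \<le> w ! l) \<longleftrightarrow> a \<notin> nonminima (take k w)"
    proof -
      have "l < length (take k w) \<and> a < l \<and> take k w ! l < take k w ! a \<longleftrightarrow>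
          l < k \<and> a < l \<and> w ! l < w ! a" for l
        using that assms length_perm_word by auto
      then have nm: "a \<in> nonminima (take k w) \<longleftrightarrow> (\<exists>l. l < k \<and> a < l \<and> w ! l < w ! a)"
        by (simp only: nonminima_def mem_Collect_eq)
      show ?thesis
        unfolding nm
      proof
        assume min: "\<forall>l\<in>{a..<k}. w ! a \<le> w ! l"
        have "w ! a \<le> w ! l" if "l < k" "a < l" for l
          using min that by simp
        then show "\<not> (\<exists>l<k. a < l \<and> w ! l < w ! a)"
          using leD by blast
      next
        assume none: "\<not> (\<exists>l<k. a < l \<and> w ! l < w ! a)"
        show "\<forall>l\<in>{a..<k}. w ! a \<le> w ! l"
        proof
          fix l assume "l \<in> {a..<k}"
          then have "l = a \<or> l < k \<and> a < l"
            by auto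
          then have "\<not> w ! l < w ! a"
            using none by blast
          then show "w ! a \<le> w ! l"
            by simp
        qed
      qed
    qed
    finally show ?thesis
      unfolding img abs_signed_word [OF a]
      using nth_perm_word [OF a] a by (simp add: signed_word_nth length_perm_word)
  qed
  have "{1..int k} = (\<lambda>j. int j + 1) ` {..<k}"
    using shift [of 0] by (simp add: lessThan_atLeast0)
  then show ?thesis
    by (simp only: ball_simps) (use step in auto)
qed

lemma npk_signed_word: "npk n (signed_word w S) = card (S \<inter> descents w)"
proof -
  let ?s = "signed_word w S"
  have "{i \<in> {1..int n - 1}. ?s i < 0 \<and> \<bar>?s i\<bar> > \<bar>?s (i + 1)\<bar>} = (\<lambda>j. int j + 1) ` (S \<inter> descents w)"
  proof (intro subset_antisym subsetI)
    fix i assume i: "i \<in> {i \<in> {1..int n - 1}. ?s i < 0 \<and> \<bar>?s i\<bar> > \<bar>?s (i + 1)\<bar>}"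
    define j where "j = nat (i - 1)"
    have ij: "i = int j + 1" "Suc j < n"
      using i by (auto simp: j_def)
    have "j \<in> S \<inter> descents w"
      using i abs_signed_word [of j S] abs_signed_word [of "Suc j" S] ij(2)
        signed_word_neg_iff [of j S]
      unfolding ij(1) by (auto simp: descents_def length_perm_word add.commute)
    then show "i \<in> (\<lambda>j. int j + 1) ` (S \<inter> descents w)"
      using ij(1) by (rule image_eqI [rotated])
  next
    fix i assume "i \<in> (\<lambda>j. int j + 1) ` (S \<inter> descents w)"
    then obtain j where j: "i = int j + 1" "j \<in> S" "Suc j < n" "w ! Suc j < w ! j"
      by (auto simp: descents_def length_perm_word)
    then show "i \<in> {i \<in> {1..int n - 1}. ?s i < 0 \<and> \<bar>?s i\<bar> > \<bar>?s (i + 1)\<bar>}"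
      using abs_signed_word [of j S] abs_signed_word [of "Suc j" S] signed_word_neg_iff [of j S]
      by (simp add: add.commute)
  qed
  then show ?thesis
    unfolding npk_def by (simp add: card_image inj_on_def)
qed

end

lemma abs_word_in_permutations:
  assumes "\<sigma> \<in> signed_perms n"
  shows "abs_word n \<sigma> \<in> permutations_of_set {1..int n}"
proof -
  have perm: "\<sigma> permutes ({- int n..-1} \<union> {1..int n})" and odd: "\<And>i. \<sigma> (- i) = - \<sigma> i"
    using assms by (auto simp: signed_perms_def)
  have inj: "inj_on (\<lambda>i. \<bar>\<sigma> i\<bar>) {1..int n}"
  proof (rule inj_onI)
    fix i j assume ij: "i \<in> {1..int n}" "j \<in> {1..int n}" and "\<bar>\<sigma> i\<bar> = \<bar>\<sigma> j\<bar>"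
    then have "\<sigma> i = \<sigma> j \<or> \<sigma> i = \<sigma> (- j)"
      by (auto simp: abs_eq_iff odd)
    then have "i = j \<or> i = - j"
      using permutes_inj [OF perm] by (auto dest: injD)
    then show "i = j"
      using ij by auto
  qed
  have "(\<lambda>i. \<bar>\<sigma> i\<bar>) ` {1..int n} \<subseteq> {1..int n}"
  proof (rule image_subsetI)
    fix i assume "i \<in> {1..int n}"
    then have "\<sigma> i \<in> {- int n..-1} \<union> {1..int n}"
      using permutes_in_image [OF perm, of i] by simp
    then show "\<bar>\<sigma> i\<bar> \<in> {1..int n}"
      by auto
  qed
  then have "(\<lambda>i. \<bar>\<sigma> i\<bar>) ` {1..int n} = {1..int n}"
    using inj by (intro endo_inj_surj) auto
  then show ?thesis
    using inj by (simp add: permutations_of_set_def abs_word_def distinct_map)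
qed

lemma signed_word_abs_word:
  assumes "\<sigma> \<in> signed_perms n"
  shows "signed_word (abs_word n \<sigma>) (neg_positions n \<sigma>) = \<sigma>"
proof
  fix i
  have perm: "\<sigma> permutes ({- int n..-1} \<union> {1..int n})" and odd: "\<And>i. \<sigma> (- i) = - \<sigma> i"
    using assms by (auto simp: signed_perms_def)
  let ?s = "signed_word (abs_word n \<sigma>) (neg_positions n \<sigma>)"
  have pos: "?s i = \<sigma> i" if "1 \<le> i" "i \<le> int n" for i
  proof -
    define j where "j = nat (i - 1)"
    have "i = int j + 1" "j < n"
      using that by (auto simp: j_def)
    then show ?thesis
      by (simp add: signed_word_nth nth_abs_word neg_positions_def)
  qed
  consider "1 \<le> i" "i \<le> int n" | "1 \<le> - i" "- i \<le> int n" | "i = 0 \<or> int n < \<bar>i\<bar>"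
    by linarith
  then show "?s i = \<sigma> i"
  proof cases
    case 1
    then show ?thesis
      by (rule pos)
  next
    case 2
    then have "?s (- i) = \<sigma> (- i)"
      by (rule pos)
    then show ?thesis
      by (simp add: signed_word_minus odd)
  next
    case 3
    then have "i \<notin> {- int n..-1} \<union> {1..int n}"
      by auto
    then show ?thesis
      using 3 permutes_not_in [OF perm] by (auto simp: signed_word_def)
  qed
qed

lemma bij_betw_signed_word:
  "bij_betw (\<lambda>(w, S). signed_word w S)
     (permutations_of_set {1..int n} \<times> Pow {..<n}) (signed_perms n)"
proof (rule bij_betw_byWitness [where f' = "\<lambda>\<sigma>. (abs_word n \<sigma>, neg_positions n \<sigma>)"])
  show "(\<lambda>\<sigma>. (abs_word n \<sigma>, neg_positions n \<sigma>)) ` signed_perms n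
      \<subseteq> permutations_of_set {1..int n} \<times> Pow {..<n}"
    using abs_word_in_permutations by (auto simp: neg_positions_def)
qed (auto simp: abs_word_signed_word neg_positions_signed_word signed_word_abs_word
      signed_word_in_signed_perms)

section \<open>The sums over signs\<close>

text \<open>
  Expand the product over \<open>N\<close> of the factors \<open>1 + q\<close> at the elements of \<open>D\<close> and \<open>1 + 1\<close> at the others.
\<close>

lemma sum_Pow_power_card_Int:
  fixes q :: "'a :: comm_semiring_1"
  assumes "finite N" "D \<subseteq> N"
  shows "(\<Sum>S\<in>Pow N. q ^ card (S \<inter> D)) = 2 ^ card (N - D) * (1 + q) ^ card D"
proof -
  define f where "f i = (if i \<in> D then q else 1)" for i
  have "(\<Prod>i\<in>S. f i) = q ^ card (S \<inter> D)" if "S \<in> Pow N" for S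
    using finite_subset [of S N] that assms(1)
    by (simp add: f_def prod.If_cases Int_def)
  then have "(\<Sum>S\<in>Pow N. q ^ card (S \<inter> D)) = (\<Prod>i\<in>N. f i + 1)"
    by (subst prod_add [OF assms(1)]) simp
  also have "\<dots> = (\<Prod>i\<in>N - D. f i + 1) * (\<Prod>i\<in>D. f i + 1)"
    using assms by (rule prod.subset_diff [rotated])
  also have "\<dots> = 2 ^ card (N - D) * (1 + q) ^ card D"
    by (simp add: f_def add.commute)
  finally show ?thesis .
qed

lemma word_weight_eq_sum:
  "word_weight w =
    (\<Sum>S\<in>Pow (nonminima w). fls_X ^ (length w + 1) * (fls_X_inv\<^sup>2) ^ card (S \<inter> descents w))"
  unfolding sum_distrib_left [symmetric]
  by (subst sum_Pow_power_card_Int) (simp_all add: descents_subset_nonminima word_weight_def mult.assoc)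

text \<open>
  The absolute values of the permutations of type D.  The first disjunct covers length one, where the
  preceding letter is \<open>\<sigma>\<^sub>0 = 0\<close>.
\<close>

definition ascending_end :: "nat \<Rightarrow> int \<Rightarrow> int list set" where
  "ascending_end n m = {w \<in> simsun n. last w = m \<and> (butlast w = [] \<or> last (butlast w) < m)}"

text \<open>
  The last position is never in \<^const>\<open>nonminima\<close>, so the last letter is positive and equals the last letter
  of the underlying word.
\<close>

lemma RSI_B_last_sum:
  assumes "1 \<le> n"
  shows "(\<Sum>\<sigma>\<in>RSI_B_last n m. fls_X_intpow (int n + 1 - 2 * int (npk n \<sigma>))) = simsun_sum n m"
proof -
  let ?D = "permutations_of_set {1..int n} \<times> Pow {..<n}"
  let ?P = "\<lambda>(w, S). w \<in> simsun n \<and> S \<subseteq> nonminima w \<and> last w = m"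
  let ?Q = "\<lambda>\<sigma>. \<sigma> \<in> RSI_B_last n m"
  have "?Q (signed_word w S) \<longleftrightarrow> ?P (w, S)" if "(w, S) \<in> ?D" for w S
  proof -
    have w: "w \<in> permutations_of_set {1..int n}" and S: "S \<subseteq> {..<n}"
      using that by auto
    have len: "length w = n"
      using length_perm_word [OF w] .
    have "(\<forall>i\<in>{1..int n}. \<bar>signed_word w S i\<bar> = Min ((\<lambda>j. \<bar>signed_word w S j\<bar>) ` {i..int n}) \<longrightarrow>
        signed_word w S i > 0) \<longleftrightarrow> S \<subseteq> nonminima w"
      using minima_positive_iff [OF w order_refl, of S] S len by (simp add: Int_absorb2)
    moreover have "signed_word w S (int n) = last w" if "S \<subseteq> nonminima w"
    proof -
      have "n - 1 \<notin> S"
        using that len by (auto simp: nonminima_def)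
      then have "signed_word w S (int (n - 1) + 1) = last w"
        using assms len by (subst signed_word_nth, simp, subst last_conv_nth) auto
      then show ?thesis
        using assms by simp
    qed
    ultimately show ?thesis
      using signed_word_in_signed_perms [OF w, of S] abs_word_signed_word [OF w, of S]
      by (auto simp: RSI_B_last_def RSI_B_def RSI_def)
  qed
  then have bij: "bij_betw (\<lambda>(w, S). signed_word w S) {x \<in> ?D. ?P x} {\<sigma> \<in> signed_perms n. ?Q \<sigma>}"
    by (intro bij_betw_Collect [OF bij_betw_signed_word]) auto
  have target: "{\<sigma> \<in> signed_perms n. ?Q \<sigma>} = RSI_B_last n m"
    by (auto simp: RSI_B_last_def RSI_B_def RSI_def)
  have source: "{x \<in> ?D. ?P x} = (SIGMA w:{w \<in> simsun n. last w = m}. Pow (nonminima w))"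
    using nonminima_subset length_simsun by (fastforce simp: simsun_iff)
  have "(\<Sum>\<sigma>\<in>RSI_B_last n m. fls_X_intpow (int n + 1 - 2 * int (npk n \<sigma>)) :: int fls) =
      (\<Sum>(w, S)\<in>(SIGMA w:{w \<in> simsun n. last w = m}. Pow (nonminima w)).
        fls_X_intpow (int n + 1 - 2 * int (npk n (signed_word w S))))"
    using sum.reindex_bij_betw [OF bij [unfolded source target], symmetric]
    by (simp add: case_prod_unfold)
  also have "\<dots> = (\<Sum>w\<in>{w \<in> simsun n. last w = m}. \<Sum>S\<in>Pow (nonminima w).
        fls_X_intpow (int n + 1 - 2 * int (npk n (signed_word w S))))"
    by (rule sum.Sigma [symmetric]) auto
  also have "\<dots> = simsun_sum n m"
    unfolding simsun_sum_def
  proof (rule sum.cong [OF refl])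
    fix w assume "w \<in> {w \<in> simsun n. last w = m}"
    then have w: "w \<in> permutations_of_set {1..int n}"
      by (simp add: simsun_iff)
    have "int n + 1 - 2 * int p = int (n + 1) - 2 * int p" for p
      by simp
    then show "(\<Sum>S\<in>Pow (nonminima w). fls_X_intpow (int n + 1 - 2 * int (npk n (signed_word w S)))) =
        word_weight w"
      by (simp only: word_weight_eq_sum npk_signed_word [OF w] fls_X_intpow_eq length_perm_word [OF w])
  qed
  finally show ?thesis .
qed

text \<open>
  Position \<open>n - 2\<close> carries a right-to-left minimum of the word without its last letter, hence is positive,
  and \<open>\<bar>\<sigma>\<^sub>n\<bar> > \<sigma>\<^sub>n\<^sub>-\<^sub>1\<close> says that the underlying word ends in an ascent.  The sign of the last letter is forced
  and its position is not a descent, so that the sum over signs only sees \<^term>\<open>butlast w\<close>; the lower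
  exponent accounts for the factor \<open>t\<^sup>-\<^sup>1\<close>.
\<close>

lemma RSI_D_last_sum:
  assumes "1 \<le> n" "1 \<le> m"
  shows "(\<Sum>\<sigma>\<in>RSI_D_last n (- m). fls_X_intpow (int n - 1 - 2 * int (npk n \<sigma>))) =
    fls_X_inv * (\<Sum>w\<in>ascending_end n m. word_weight (butlast w))"
proof -
  let ?D = "permutations_of_set {1..int n} \<times> Pow {..<n}"
  let ?P = "\<lambda>(w, S). w \<in> ascending_end n m \<and> n - 1 \<in> S \<and> S \<inter> {..<n - 1} \<subseteq> nonminima (butlast w)"
  let ?Q = "\<lambda>\<sigma>. \<sigma> \<in> RSI_D_last n (- m)"
  have "?Q (signed_word w S) \<longleftrightarrow> ?P (w, S)" if "(w, S) \<in> ?D" for w S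
  proof -
    have w: "w \<in> permutations_of_set {1..int n}" and S: "S \<subseteq> {..<n}"
      using that by auto
    have len: "length w = n"
      using length_perm_word [OF w] .
    have but: "butlast w = take (n - 1) w"
      by (simp add: butlast_conv_take len)
    let ?s = "signed_word w S"
    have min: "(\<forall>i\<in>{1..int n - 1}. \<bar>?s i\<bar> = Min ((\<lambda>j. \<bar>?s j\<bar>) ` {i..int n - 1}) \<longrightarrow> ?s i > 0)
        \<longleftrightarrow> S \<inter> {..<n - 1} \<subseteq> nonminima (butlast w)"
      using minima_positive_iff [OF w, of "n - 1" S] assms by (simp add: but of_nat_diff)
    have last: "last w = w ! (n - 1)"
      using assms len by (subst last_conv_nth) auto
    have sn: "?s (int n) = (if n - 1 \<in> S then - last w else last w)" "\<bar>?s (int n)\<bar> = last w"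
        "1 \<le> last w"
      using signed_word_nth [of "n - 1" w S] abs_signed_word [OF w, of "n - 1" S]
        nth_perm_word [OF w, of "n - 1"] assms len by (auto simp: last)
    have asc: "last w > ?s (int n - 1) \<longleftrightarrow> butlast w = [] \<or> last (butlast w) < last w"
      if "S \<inter> {..<n - 1} \<subseteq> nonminima (butlast w)"
    proof (cases "n = 1")
      case True
      then show ?thesis
        using sn(3) len by (simp add: but signed_word_def)
    next
      case False
      with assms have n: "2 \<le> n"
        by simp
      have "n - 2 \<notin> nonminima (butlast w)"
        using n len by (auto simp: nonminima_def)
      then have "n - 2 \<notin> S"
        using that n by auto
      then have "?s (int (n - 2) + 1) = w ! (n - 2)"
        using n len by (subst signed_word_nth) auto
      moreover have "int (n - 2) + 1 = int n - 1"
        using n by simp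
      moreover have "butlast w \<noteq> []"
        using n len by (auto simp: but)
      moreover from this have "last (butlast w) = w ! (n - 2)"
        using n len by (subst last_conv_nth) (auto simp: but numeral_2_eq_2)
      ultimately show ?thesis
        by simp
    qed
    show ?thesis
      using signed_word_in_signed_perms [OF w, of S] abs_word_signed_word [OF w, of S] min asc sn assms(2)
      by (auto simp: RSI_D_last_def RSI_D_def RSI_def ascending_end_def)
  qed
  then have bij: "bij_betw (\<lambda>(w, S). signed_word w S) {x \<in> ?D. ?P x} {\<sigma> \<in> signed_perms n. ?Q \<sigma>}"
    by (intro bij_betw_Collect [OF bij_betw_signed_word]) auto
  have target: "{\<sigma> \<in> signed_perms n. ?Q \<sigma>} = RSI_D_last n (- m)"
    by (auto simp: RSI_D_last_def RSI_D_def RSI_def)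
  let ?E = "SIGMA w:ascending_end n m. Pow (nonminima (butlast w))"
  have fin: "finite (ascending_end n m)"
    by (simp add: ascending_end_def)
  have words: "w \<in> permutations_of_set {1..int n}" if "w \<in> ascending_end n m" for w
    using that by (simp add: ascending_end_def simsun_iff)
  have sub: "nonminima (butlast w) \<subseteq> {..<n - 1}" if "w \<in> ascending_end n m" for w
    using nonminima_subset [of "butlast w"] length_perm_word [OF words [OF that]] by simp
  have "(\<Sum>\<sigma>\<in>RSI_D_last n (- m). fls_X_intpow (int n - 1 - 2 * int (npk n \<sigma>)) :: int fls) =
      (\<Sum>(w, S)\<in>{x \<in> ?D. ?P x}. fls_X_intpow (int n - 1 - 2 * int (npk n (signed_word w S))))"
    using sum.reindex_bij_betw [OF bij [unfolded target], symmetric]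
    by (simp add: case_prod_unfold)
  also have "\<dots> = (\<Sum>(w, S)\<in>?E. fls_X ^ (n - 1) * (fls_X_inv\<^sup>2) ^ card (S \<inter> descents (butlast w)))"
  proof (rule sum.reindex_bij_witness [where i = "\<lambda>(w, S). (w, insert (n - 1) S)"
        and j = "\<lambda>(w, S). (w, S - {n - 1})"])
    fix x assume "x \<in> {x \<in> ?D. ?P x}"
    then obtain w S where x: "x = (w, S)" and w: "w \<in> ascending_end n m" and S: "S \<subseteq> {..<n}"
      and n: "n - 1 \<in> S" and sub': "S \<inter> {..<n - 1} \<subseteq> nonminima (butlast w)"
      by auto
    show "(\<lambda>(w, S). (w, insert (n - 1) S)) ((\<lambda>(w, S). (w, S - {n - 1})) x) = x"
      using n by (auto simp: x)
    have S': "S - {n - 1} = S \<inter> {..<n - 1}"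
      using S by auto
    then show "(\<lambda>(w, S). (w, S - {n - 1})) x \<in> ?E"
      using w sub' by (simp add: x)
    note p = words [OF w]
    have "w \<noteq> []"
      using length_perm_word [OF p] assms by auto
    moreover have "last w = m"
      using w by (simp add: ascending_end_def)
    ultimately have "butlast w @ [m] = w"
      using append_butlast_last_id by blast
    then have "descents w = descents (butlast w @ [m])"
      by (simp only:)
    also have "descents (butlast w @ [m]) = descents (butlast w)"
      using w by (intro descents_snoc) (simp add: ascending_end_def)
    finally have desc: "descents w = descents (butlast w)" .
    have "descents (butlast w) \<subseteq> {..<n - 1}"
      using sub [OF w] descents_subset_nonminima by blast
    then have "S \<inter> descents w = (S - {n - 1}) \<inter> descents (butlast w)"
      by (auto simp: desc)
    moreover have "int n - 1 - 2 * int p = int (n - 1) - 2 * int p" for p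
      using assms by simp
    ultimately show "(\<lambda>(w, S). fls_X ^ (n - 1) * (fls_X_inv\<^sup>2) ^ card (S \<inter> descents (butlast w)) :: int fls)
        ((\<lambda>(w, S). (w, S - {n - 1})) x) =
        (\<lambda>(w, S). fls_X_intpow (int n - 1 - 2 * int (npk n (signed_word w S)))) x"
      by (simp only: x prod.case npk_signed_word [OF p] fls_X_intpow_eq)
  next
    fix x assume "x \<in> ?E"
    then obtain w S where x: "x = (w, S)" and w: "w \<in> ascending_end n m"
      and S: "S \<subseteq> nonminima (butlast w)"
      by auto
    have Sn: "S \<subseteq> {..<n - 1}"
      using S sub [OF w] by blast
    then show "(\<lambda>(w, S). (w, S - {n - 1})) ((\<lambda>(w, S). (w, insert (n - 1) S)) x) = x"
      by (auto simp: x)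
    have "insert (n - 1) S \<subseteq> {..<n}"
      using Sn assms by auto
    then show "(\<lambda>(w, S). (w, insert (n - 1) S)) x \<in> {x \<in> ?D. ?P x}"
      using w S words [OF w] by (auto simp: x)
  qed
  also have "\<dots> = (\<Sum>w\<in>ascending_end n m. \<Sum>S\<in>Pow (nonminima (butlast w)).
      fls_X ^ (n - 1) * (fls_X_inv\<^sup>2) ^ card (S \<inter> descents (butlast w)))"
    using fin by (intro sum.Sigma [symmetric]) auto
  also have "\<dots> = (\<Sum>w\<in>ascending_end n m. fls_X_inv * word_weight (butlast w))"
  proof (rule sum.cong [OF refl])
    fix w assume "w \<in> ascending_end n m"
    then have len: "length (butlast w) + 1 = n"
      using length_perm_word [OF words] assms by simp
    have "fls_X ^ (n - 1) = (fls_X_inv * fls_X ^ n :: int fls)"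
      using assms fls_X_times_X_inv [where 'a = int]
      by (cases n) (simp_all add: algebra_simps flip: mult.assoc)
    then show "(\<Sum>S\<in>Pow (nonminima (butlast w)).
        fls_X ^ (n - 1) * (fls_X_inv\<^sup>2) ^ card (S \<inter> descents (butlast w))) =
        fls_X_inv * word_weight (butlast w)"
      by (simp only: word_weight_eq_sum len sum_distrib_left mult.assoc)
  qed
  finally show ?thesis
    by (simp add: sum_distrib_left)
qed

theorem theorem2p8:
  fixes n k :: nat
  assumes "1 \<le> k" and "k \<le> n"
  shows "V n (int k) =
           (\<Sum>\<sigma>\<in>RSI_B_last n (int n - int k + 1). fls_X_intpow (int n + 1 - 2 * int (npk n \<sigma>)))
       \<and> V n (- int k) =
           (\<Sum>\<sigma>\<in>RSI_D_last n (- int n + int k - 1). fls_X_intpow (int n - 1 - 2 * int (npk n \<sigma>)))"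
proof -
  define d where "d n m = fls_X_inv * (\<Sum>w\<in>ascending_end n m. word_weight (butlast w))" for n m
  have d_1: "d 1 1 = 1"
  proof -
    have "permutations_of_set {1..int 1} = {[1]}"
      by simp
    moreover have "simsun_word [1]"
      by (simp add: simsun_word_def has_double_descent_def)
    ultimately have "w \<in> simsun 1 \<longleftrightarrow> w = [1]" for w
      unfolding simsun_iff by blast
    then have "ascending_end 1 1 = {w. w = [1] \<and> last w = 1 \<and> (butlast w = [] \<or> last (butlast w) < 1)}"
      by (simp only: ascending_end_def)
    also have "\<dots> = {[1]}"
      by auto
    finally have "d 1 1 = fls_X_inv * (\<Sum>w\<in>{[1]}. word_weight (butlast w))"
      by (simp only: d_def)
    then show ?thesis
      by (simp add: word_weight_def fls_X_times_X_inv mult.commute [of fls_X_inv])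
  qed
  have d_append: "d n m = fls_X_inv * (\<Sum>j\<in>{1..<m}. simsun_sum (n - 1) j)"
    if "2 \<le> n" "1 \<le> m" "m \<le> int n" for n m
  proof -
    have "butlast w \<noteq> []" if "w \<in> simsun n" for w
      using length_simsun [OF that] \<open>2 \<le> n\<close> by (cases w rule: rev_cases) auto
    then have "ascending_end n m = {w \<in> simsun n. last w = m \<and> last (butlast w) < m}"
      unfolding ascending_end_def by blast
    then show ?thesis
      by (simp only: d_def sum_butlast_weight [OF that])
  qed
  (* If the last letter is n, the word automatically ends in an ascent, and removing that letter
     changes neither the descents nor the free positions, but divides the weight by t. *)
  have b_max: "simsun_sum n (int n) = fls_X\<^sup>2 * d n (int n)" if n: "1 \<le> n" for n
  proof -
    have snoc: "w = butlast w @ [int n]" and below: "\<And>b. b \<in> set (butlast w) \<Longrightarrow> b < int n"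
      if "w \<in> simsun n" "last w = int n" for w
    proof -
      have "w \<noteq> []"
        using length_simsun [OF that(1)] n by auto
      then show w: "w = butlast w @ [int n]"
        using that(2) append_butlast_last_id [of w] by simp
      fix b assume b: "b \<in> set (butlast w)"
      have "distinct (butlast w @ [int n])"
        using distinct_simsun [OF that(1)] w by argo
      with b have "b \<noteq> int n"
        by auto
      moreover have "b \<le> int n"
        using in_set_butlastD [OF b] set_simsun [OF that(1)] by simp
      ultimately show "b < int n"
        by simp
    qed
    have "last (butlast w) < int n"
      if "w \<in> simsun n" "last w = int n" "butlast w \<noteq> []" for w
      using below [OF that(1,2)] last_in_set [OF that(3)] .
    then have asc: "{w \<in> simsun n. last w = int n} = ascending_end n (int n)"
      unfolding ascending_end_def by blast
    have weight: "word_weight w = fls_X * word_weight (butlast w)" if "w \<in> ascending_end n (int n)" for w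
    proof -
      have w: "w = butlast w @ [int n]" and lt: "\<And>b. b \<in> set (butlast w) \<Longrightarrow> \<not> int n < b"
        and last: "butlast w = [] \<or> last (butlast w) < int n"
        using snoc [of w] below [of w, THEN order.asym] that unfolding ascending_end_def by blast+
      have "descents w = descents (butlast w)"
        by (subst w) (rule descents_snoc [OF last])
      moreover have "nonminima w = nonminima (butlast w)"
        by (subst w) (rule nonminima_snoc [OF lt])
      moreover have "length w = length (butlast w) + 1"
        by (subst w) (simp only: length_append_singleton Suc_eq_plus1)
      ultimately show ?thesis
        by (simp add: word_weight_def mult.assoc)
    qed
    have cancel: "fls_X\<^sup>2 * (fls_X_inv * f) = fls_X * f" for f :: "int fls"
    proof -
      have "fls_X\<^sup>2 * (fls_X_inv * f) = fls_X * ((fls_X * fls_X_inv) * f)"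
        by (simp only: power2_eq_square mult.assoc)
      also have "\<dots> = fls_X * f"
        by (simp only: fls_X_times_X_inv mult_1_left)
      finally show ?thesis .
    qed
    have "(\<Sum>w\<in>ascending_end n (int n). word_weight w) =
        (\<Sum>w\<in>ascending_end n (int n). fls_X * word_weight (butlast w))"
      by (rule sum.cong [OF refl weight])
    then show ?thesis
      by (simp only: simsun_sum_def d_def asc cancel sum_distrib_left [symmetric])
  qed
  have "V n (int k) = simsun_sum n (int n - int k + 1) \<and> V n (- int k) = d n (int n - int k + 1)"
    using simsun_sum_insert_max d_1 d_append b_max assms by (rule V_eq_by_recurrences)
  moreover have "- int n + int k - 1 = - (int n - int k + 1)"
    by simp
  ultimately show ?thesis
    using assms by (simp only: RSI_B_last_sum RSI_D_last_sum d_def)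
qed

end
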